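(* Let $n\geq 1$. Suppose $\mathfrak b=\mathfrak d=\aleph_n$ and $\mathrm w\diamondsuit(S^k_{k+1})$ holds for every $k<n$. Then $\lim^n\mathbf A\neq 0$.
   Context: $\mathfrak b$ and $\mathfrak d$ are the bounding and dominating numbers of $(\omega^\omega,\le^* )$. For $k<\omega$, $S^k_{k+1}=\{\alpha<\omega_{k+1}:\operatorname{cof}(\alpha)=\omega_k\}$. For a regular uncountable cardinal $\kappa$ and stationary $S\subseteq\kappa$, $\mathrm w\diamondsuit(S)$ is the statement: for every $F:2^{<\kappa}\to 2$ there is $g:\kappa\to2$ such that for every $f:\kappa\to 2$ the set $\{\alpha\in S:g(\alpha)=F(f\restriction\alpha)\}$ is stationary. The system $\mathbf A$: let $\mathcal I_0$ be the ideal on $\omega\times\omega$ generated by the sets $a_f=\{(i,j)\in\omega\times\omega: j\leq f(i)\}$ for $f\in\omega^\omega$. For $a\in\mathcal I_0$ let $A_a=\bigoplus_{(i,j)\in a}\mathbb Z$, and for $a\subseteq b$ in $\mathcal I_0$ let $p^b_a:A_b\to A_a$ be the natural projection; $\mathbf A$ is this inverse system indexed by $(\mathcal I_0,\subseteq)$. For a directed set $(\Lambda,\le)$ and a $\Lambda$-inverse system $\mathbf G=\{G_\lambda;p^\mu_\lambda\}$: $\Lambda^{(n)}$ is the set of tuples $(\lambda_0,\dots,\lambda_n)$ with $\lambda_0\leq\dots\leq\lambda_n$; $\bar\lambda^i$ is $\bar\lambda$ with the $i$-th entry removed; $\mathbf G^{(n)}$ is the group of functions $\bar x$ on $\Lambda^{(n)}$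 with $x_{\bar\lambda}\in G_{\lambda_0}$, $\mathbf G^{(-1)}=0$; $\delta^n(\bar x)_{\bar\lambda}=\sum_{1\le i\le n}(-1)^ix_{\bar\lambda^i}+p^{\lambda_1}_{\lambda_0}(x_{\bar\lambda^0})$ for $n\ge1$, $\delta^0=0$; $\lim^n\mathbf G=\ker(\delta^{n+1})/\operatorname{im}(\delta^n)$. *)

theory Defs
  imports "HOL-Algebra.FiniteProduct" "HOL-Algebra.Product_Groups"
begin

unbundle cardinal_syntax

section \<open>Cardinals and ordinals as well-orders\<close>

text \<open>An infinite cardinal is represented, as in the library, by a well-order (on a subset of some
  type) satisfying \<^const>\<open>Card_order\<close>; such a well-order at the same time represents the initial
  ordinal. Thus \<open>is_aleph k r\<close> says that \<open>r\<close> is a well-order of type \<open>\<omega>\<^sub>k\<close>. A type large enough for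
  \<open>\<omega>\<^sub>k\<^sub>+\<^sub>1\<close> is large enough for \<open>\<omega>\<^sub>k\<close>, so the recursion can stay within one type.\<close>

primrec is_aleph :: "nat \<Rightarrow> 'a rel \<Rightarrow> bool" where
  "is_aleph 0 r \<longleftrightarrow> Card_order r \<and> r =o natLeq"
| "is_aleph (Suc k) r \<longleftrightarrow> Card_order r \<and> (\<exists>s :: 'a rel. is_aleph k s \<and> r =o cardSuc s)"

text \<open>The least cardinality of a member of a nonempty family of sets (determined, like
  \<^const>\<open>cardSuc\<close>, only up to \<^const>\<open>ordIso\<close>).\<close>

definition min_card :: "'a set set \<Rightarrow> 'a rel" where
  "min_card \<X> = (SOME c. c \<in> card_of ` \<X> \<and> (\<forall>X\<in>\<X>. c \<le>o |X| ))"

lemma min_card: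
  assumes "\<X> \<noteq> {}"
  shows "min_card \<X> \<in> card_of ` \<X>" and "\<And>X. X \<in> \<X> \<Longrightarrow> min_card \<X> \<le>o |X|"
proof -
  have "\<exists>c\<in>card_of ` \<X>. \<forall>d\<in>card_of ` \<X>. c \<le>o d"
    by (rule exists_minim_Card_order) (use assms in \<open>auto simp: card_of_Card_order\<close>)
  then have "\<exists>c. c \<in> card_of ` \<X> \<and> (\<forall>X\<in>\<X>. c \<le>o |X| )"
    by auto
  from someI_ex[OF this]
  show "min_card \<X> \<in> card_of ` \<X>" and "\<And>X. X \<in> \<X> \<Longrightarrow> min_card \<X> \<le>o |X|"
    unfolding min_card_def[symmetric] by auto
qed

lemma is_aleph_le_ex:
  fixes r :: "'a rel"
  assumes "is_aleph n r" "k \<le> n"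
  shows "\<exists>s :: 'a rel. is_aleph k s"
  using assms
proof (induction n arbitrary: r)
  case (Suc n)
  then show ?case by (cases "k = Suc n") (auto simp: le_Suc_eq)
qed auto


section \<open>The bounding and dominating numbers\<close>

definition le_star :: "(nat \<Rightarrow> nat) \<Rightarrow> (nat \<Rightarrow> nat) \<Rightarrow> bool" (infix \<open>\<le>\<^sup>*\<close> 50) where
  "f \<le>\<^sup>* g \<longleftrightarrow> (\<forall>\<^sub>F i in sequentially. f i \<le> g i)"

definition bounding_number :: "(nat \<Rightarrow> nat) rel" where
  "bounding_number = min_card {B. \<not> (\<exists>g. \<forall>f\<in>B. f \<le>\<^sup>* g)}"

definition dominating_number :: "(nat \<Rightarrow> nat) rel" where
  "dominating_number = min_card {D. \<forall>f. \<exists>g\<in>D. f \<le>\<^sup>* g}"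


section \<open>Stationary sets and the weak diamond\<close>

text \<open>Throughout, the ordinal is the well-order \<open>r\<close>, an element \<open>a\<close> of \<^term>\<open>Field r\<close> is an ordinal
  below it, and \<^term>\<open>underS r a\<close> is the set of ordinals below \<open>a\<close>.\<close>

text \<open>The comparison with \<open>X\<close> is non-strict, unlike in \<^const>\<open>cofinal\<close>, so that successor ordinals
  have cofinality 1.\<close>

definition cofinality :: "'a rel \<Rightarrow> 'a rel" where
  "cofinality r = min_card {X. X \<subseteq> Field r \<and> (\<forall>a\<in>Field r. \<exists>x\<in>X. (a, x) \<in> r)}"

text \<open>For \<open>r\<close> of order type \<open>\<omega>\<^sub>k\<^sub>+\<^sub>1\<close>, this is \<open>S\<close> with superscript \<open>k\<close> and subscript \<open>k + 1\<close>.\<close>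

definition cof_points :: "nat \<Rightarrow> 'a rel \<Rightarrow> 'a set" where
  "cof_points k r = {a \<in> Field r. is_aleph k (cofinality (Restr r (underS r a)))}"

text \<open>The closure condition can only apply to \<open>a\<close> that are limit ordinals: \<open>C\<close> being strictly
  unbounded below \<open>a\<close> excludes successors, and \<open>underS r a \<noteq> {}\<close> excludes 0.\<close>

definition club :: "'a rel \<Rightarrow> 'a set \<Rightarrow> bool" where
  "club r C \<longleftrightarrow> C \<subseteq> Field r \<and> (\<forall>a\<in>Field r. \<exists>c\<in>C. (a, c) \<in> r) \<and>
     (\<forall>a\<in>Field r. underS r a \<noteq> {} \<and> (\<forall>b\<in>underS r a. \<exists>c\<in>C \<inter> underS r a. b \<in> underS r c) \<longrightarrow> a \<in> C)"

definition stationary :: "'a rel \<Rightarrow> 'a set \<Rightarrow> bool" where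
  "stationary r S \<longleftrightarrow> S \<subseteq> Field r \<and> (\<forall>C. club r C \<longrightarrow> S \<inter> C \<noteq> {})"

text \<open>An element of \<open>2\<close> to the power of an ordinal \<open>a\<close> is a partial function with domain
  \<^term>\<open>underS r a\<close>; the values of \<open>F\<close> at other partial functions are irrelevant.\<close>

definition weak_diamond :: "'a rel \<Rightarrow> 'a set \<Rightarrow> bool" where
  "weak_diamond r S \<longleftrightarrow>
     (\<forall>F :: ('a \<rightharpoonup> bool) \<Rightarrow> bool. \<exists>g :: 'a \<Rightarrow> bool. \<forall>f :: 'a \<Rightarrow> bool.
        stationary r {a \<in> S. g a = F ((\<lambda>b. Some (f b)) |` underS r a)})"


section \<open>Derived limits of inverse systems\<close>

text \<open>An inverse system over the set \<open>L\<close> ordered by \<open>leq\<close> consists of abelian groups \<open>G l\<close> (written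
  multiplicatively, as always in HOL-Algebra) and maps \<open>p l m\<close> from \<open>G m\<close> to \<open>G l\<close> for \<open>leq l m\<close>.\<close>

definition tuples :: "'l set \<Rightarrow> ('l \<Rightarrow> 'l \<Rightarrow> bool) \<Rightarrow> nat \<Rightarrow> 'l list set" where
  "tuples L leq n = {ls. set ls \<subseteq> L \<and> length ls = Suc n \<and> sorted_wrt leq ls}"

definition remove_nth :: "nat \<Rightarrow> 'l list \<Rightarrow> 'l list" where
  "remove_nth i ls = take i ls @ drop (Suc i) ls"

definition cochain_group ::
    "'l set \<Rightarrow> ('l \<Rightarrow> 'l \<Rightarrow> bool) \<Rightarrow> ('l \<Rightarrow> 'g monoid) \<Rightarrow> nat \<Rightarrow> ('l list \<Rightarrow> 'g) monoid" where
  "cochain_group L leq G n = product_group (tuples L leq n) (\<lambda>ls. G (ls ! 0))"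

text \<open>The map \<open>\<delta>\<close> from \<^term>\<open>cochain_group L leq G (n - 1)\<close> to \<^term>\<open>cochain_group L leq G n\<close>, for
  \<open>n \<ge> 1\<close>.\<close>

definition coboundary ::
    "'l set \<Rightarrow> ('l \<Rightarrow> 'l \<Rightarrow> bool) \<Rightarrow> ('l \<Rightarrow> 'g monoid) \<Rightarrow> ('l \<Rightarrow> 'l \<Rightarrow> 'g \<Rightarrow> 'g) \<Rightarrow> nat
      \<Rightarrow> ('l list \<Rightarrow> 'g) \<Rightarrow> 'l list \<Rightarrow> 'g" where
  "coboundary L leq G p n x = (\<lambda>ls\<in>tuples L leq n.
     (\<Otimes>\<^bsub>G (ls ! 0)\<^esub>i\<in>{1..n}. x (remove_nth i ls) [^]\<^bsub>G (ls ! 0)\<^esub> ((- 1) ^ i :: int))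
       \<otimes>\<^bsub>G (ls ! 0)\<^esub> p (ls ! 0) (ls ! 1) (x (remove_nth 0 ls)))"

definition cocycles ::
    "'l set \<Rightarrow> ('l \<Rightarrow> 'l \<Rightarrow> bool) \<Rightarrow> ('l \<Rightarrow> 'g monoid) \<Rightarrow> ('l \<Rightarrow> 'l \<Rightarrow> 'g \<Rightarrow> 'g) \<Rightarrow> nat
      \<Rightarrow> ('l list \<Rightarrow> 'g) set" where
  "cocycles L leq G p n =
     kernel (cochain_group L leq G n) (cochain_group L leq G (Suc n)) (coboundary L leq G p (Suc n))"

definition coboundaries ::
    "'l set \<Rightarrow> ('l \<Rightarrow> 'l \<Rightarrow> bool) \<Rightarrow> ('l \<Rightarrow> 'g monoid) \<Rightarrow> ('l \<Rightarrow> 'l \<Rightarrow> 'g \<Rightarrow> 'g) \<Rightarrow> nat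
      \<Rightarrow> ('l list \<Rightarrow> 'g) set" where
  "coboundaries L leq G p n =
     (if n = 0 then {\<one>\<^bsub>cochain_group L leq G 0\<^esub>}
      else coboundary L leq G p n ` carrier (cochain_group L leq G (n - 1)))"

definition derived_limit ::
    "'l set \<Rightarrow> ('l \<Rightarrow> 'l \<Rightarrow> bool) \<Rightarrow> ('l \<Rightarrow> 'g monoid) \<Rightarrow> ('l \<Rightarrow> 'l \<Rightarrow> 'g \<Rightarrow> 'g) \<Rightarrow> nat
      \<Rightarrow> ('l list \<Rightarrow> 'g) set monoid" where
  "derived_limit L leq G p n =
     (cochain_group L leq G n)\<lparr>carrier := cocycles L leq G p n\<rparr> Mod coboundaries L leq G p n"


section \<open>The system A\<close>

definition ideal_generated :: "'a set set \<Rightarrow> 'a set set" where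
  "ideal_generated \<S> = {a. \<exists>\<F>. finite \<F> \<and> \<F> \<subseteq> \<S> \<and> a \<subseteq> \<Union>\<F>}"

definition I0 :: "(nat \<times> nat) set set" where
  "I0 = ideal_generated (range (\<lambda>f :: nat \<Rightarrow> nat. {(i, j). j \<le> f i}))"

definition A_group :: "(nat \<times> nat) set \<Rightarrow> (nat \<times> nat \<Rightarrow> int) monoid" where
  "A_group a = sum_group a (\<lambda>_. integer_group)"

definition A_proj ::
    "(nat \<times> nat) set \<Rightarrow> (nat \<times> nat) set \<Rightarrow> (nat \<times> nat \<Rightarrow> int) \<Rightarrow> (nat \<times> nat \<Rightarrow> int)" where
  "A_proj a b x = restrict x a"

definition lim_A :: "nat \<Rightarrow> ((nat \<times> nat) set list \<Rightarrow> nat \<times> nat \<Rightarrow> int) set monoid" where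
  "lim_A n = derived_limit I0 (\<subseteq>) A_group A_proj n"

end

theory Submission
  imports Defs "HOL-Library.Countable_Set"
begin

text \<open>Since \<open>\<bb> = \<dd> = \<aleph>\<^sub>n\<close>, there is a scale of length \<open>\<omega>\<^sub>n\<close>, that is, a cofinal strictly increasing
  (modulo finite sets) sequence of members \<open>a\<^sub>\<xi>\<close> of the ideal. By induction on \<open>k\<close>, every
  strictly increasing sequence of length \<open>\<omega>\<^sub>k\<close> carries a cocycle modulo finite, defined on \<open>k\<close>-tuples
  of indices, that is not a coboundary modulo finite. In the step it is built by recursion on \<open>\<alpha> < \<omega>\<^sub>k\<^sub>+\<^sub>1\<close>:
  an extension to \<open>\<alpha>\<close> exists because cocycles of this degree on \<open>\<aleph>\<^sub>k\<close> indices are trivial, and at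
  \<open>\<alpha>\<close> of cofinality \<open>\<omega>\<^sub>k\<close> there are two extensions such that no trivialization below \<open>\<alpha>\<close> survives
  both; the weak diamond makes the choices so that every potential trivialization is killed. Finally,
  pulling the cocycle on the scale back to chains in the ideal gives an integer-valued cochain \<open>\<Phi>\<close>
  whose coboundary has finite supports. If this were the coboundary of a finitely supported \<open>y\<close>, then
  \<open>\<Phi> - y\<close> would be a genuine cocycle, hence a coboundary (by the cone over the singletons), and this
  would trivialize the cocycle on the scale.\<close>

section \<open>Cochains on arbitrary tuples, modulo finite errors\<close>

text \<open>The obstacle is a mismatch of orders: derived limits see inclusion chains in the ideal,
  while the scale increases only modulo finite sets. Cocycles are therefore built on all tuples of
  indices, but their trivializations are asked for only on inclusion chains of finite modifications
  of the sets \<open>a \<xi>\<close>. Triviality in this sense is easier to achieve, so its failure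
  is the stronger statement, and that statement passes through the induction. Such trivializations
  can still be guessed, because a subset of a countable set has only countably many finite
  modifications, so fewer than \<open>\<aleph>\<^sub>k\<^sub>+\<^sub>1\<close> chains occur below
  each \<alpha>. The bound \<open>c\<close> comes from the step at \<alpha>: the single set
  \<open>a \<alpha> \<inter> c\<close> is appended to chains, so these must lie inside it, and it
  becomes the bound one degree lower. Passing from \<phi> to the coboundary of its pullback is the
  connecting map for direct sums inside full products. It raises the degree by one, which is why a
  cochain on \<open>n\<close>-tuples yields a class in degree \<open>n\<close>.\<close>

text \<open>The differential of the augmented complex: cochains live on all lists of indices, with
  repetitions and in any order, and the empty list carries the augmentation. So a 0-cochain in the
  usual sense lives on lists of length 1.\<close>

primrec cobd :: "('i list \<Rightarrow> 'v::ab_group_add) \<Rightarrow> 'i list \<Rightarrow> 'v" where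
  "cobd \<chi> [] = 0"
| "cobd \<chi> (i # l) = \<chi> l - cobd (\<lambda>m. \<chi> (i # m)) l"

declare cobd.simps(2) [simp del]

lemma cobd_zero [simp]: "cobd (\<lambda>_. 0) l = 0"
  by (induction l) (simp_all add: cobd.simps)

lemma cobd_add: "cobd (\<lambda>m. \<chi> m + \<psi> m) l = cobd \<chi> l + cobd \<psi> l"
  by (induction l arbitrary: \<chi> \<psi>) (simp_all add: cobd.simps)

lemma cobd_diff: "cobd (\<lambda>m. \<chi> m - \<psi> m) l = cobd \<chi> l - cobd \<psi> l"
  by (induction l arbitrary: \<chi> \<psi>) (simp_all add: cobd.simps)

lemma cobd_cobd: "cobd (cobd \<chi>) l = 0"
proof (induction l arbitrary: \<chi>)
  case (Cons i l)
  show ?case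
    by (simp add: cobd.simps cobd_diff Cons.IH)
qed simp

text \<open>The recursion for \<open>cobd\<close> peels off the first entry, but the construction
  adds new indices and sets at the top, as last entries. If \<chi> vanishes on lists ending in
  \<open>i\<close>, only its value at \<open>l\<close> survives, up to sign.\<close>

lemma cobd_snoc:
  "cobd \<chi> (l @ [i]) = cobd (\<lambda>m. \<chi> (m @ [i])) l + (if even (length l) then \<chi> l else - \<chi> l)"
  by (induction l arbitrary: \<chi>) (auto simp: cobd.simps)

lemma cobd_cong:
  assumes "\<And>m. set m \<subseteq> set l \<Longrightarrow> Suc (length m) = length l \<Longrightarrow> \<chi> m = \<psi> m"
  shows "cobd \<chi> l = cobd \<psi> l"
  using assms
proof (induction l arbitrary: \<chi> \<psi>)
  case (Cons i l)
  have "cobd (\<lambda>m. \<chi> (i # m)) l = cobd (\<lambda>m. \<psi> (i # m)) l"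
    by (rule Cons.IH) (auto intro!: Cons.prems)
  moreover have "\<chi> l = \<psi> l"
    by (rule Cons.prems) auto
  ultimately show ?case
    by (simp add: cobd.simps)
qed simp

lemma cobd_map: "cobd \<chi> (map f l) = cobd (\<lambda>m. \<chi> (map f m)) l"
  by (induction l arbitrary: \<chi>) (simp_all add: cobd.simps)

text \<open>The alternating sum is the shape in which \<open>coboundary\<close> is given.\<close>

lemma cobd_eq_sum:
  fixes \<chi> :: "'i list \<Rightarrow> 'v::comm_ring_1"
  shows "cobd \<chi> l = (\<Sum>i<length l. (- 1) ^ i * \<chi> (remove_nth i l))"
proof (induction l arbitrary: \<chi>)
  case (Cons i l)
  have "remove_nth 0 (i # l) = l" "remove_nth (Suc j) (i # l) = i # remove_nth j l" for j
    by (simp_all add: remove_nth_def)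
  then show ?case
    by (simp add: cobd.simps Cons.IH sum.lessThan_Suc_shift sum_negf del: sum.lessThan_Suc)
qed simp


section \<open>Equality up to finitely many points, and cocycles with respect to it\<close>

definition aeq :: "'p set \<Rightarrow> ('p \<Rightarrow> 'v) \<Rightarrow> ('p \<Rightarrow> 'v) \<Rightarrow> bool" where
  "aeq s f g \<longleftrightarrow> finite {p \<in> s. f p \<noteq> g p}"

lemma aeq_refl [simp]: "aeq s f f"
  by (simp add: aeq_def)

lemma aeq_sym: "aeq s f g \<Longrightarrow> aeq s g f"
  by (simp add: aeq_def eq_commute)

lemma aeq_trans: "aeq s f g \<Longrightarrow> aeq s g h \<Longrightarrow> aeq s f h"
  unfolding aeq_def by (rule finite_subset[of _ "{p \<in> s. f p \<noteq> g p} \<union> {p \<in> s. g p \<noteq> h p}"]) auto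

lemma aeq_add: "aeq s f g \<Longrightarrow> aeq s f' g' \<Longrightarrow> aeq s (\<lambda>p. f p + f' p) (\<lambda>p. g p + g' p)"
  unfolding aeq_def by (rule finite_subset[of _ "{p \<in> s. f p \<noteq> g p} \<union> {p \<in> s. f' p \<noteq> g' p}"]) auto

lemma aeq_diff: "aeq s f g \<Longrightarrow> aeq s f' g' \<Longrightarrow> aeq s (\<lambda>p. f p - f' p) (\<lambda>p. g p - g' p)"
  unfolding aeq_def by (rule finite_subset[of _ "{p \<in> s. f p \<noteq> g p} \<union> {p \<in> s. f' p \<noteq> g' p}"]) auto

lemma aeq_mono: "aeq s f g \<Longrightarrow> finite (t - s) \<Longrightarrow> aeq t f g"
  unfolding aeq_def by (rule finite_subset[of _ "{p \<in> s. f p \<noteq> g p} \<union> (t - s)"]) auto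

text \<open>Only finitely many lists \<open>m\<close> enter \<open>cobd\<close> at \<open>l\<close>,
  so their exceptional sets have a finite union.\<close>

lemma aeq_cobd:
  assumes "\<And>m. set m \<subseteq> set l \<Longrightarrow> Suc (length m) = length l \<Longrightarrow> aeq s (\<chi> m) (\<psi> m)"
  shows "aeq s (\<lambda>p. cobd (\<lambda>m. \<chi> m p) l) (\<lambda>p. cobd (\<lambda>m. \<psi> m p) l)"
proof -
  let ?M = "{m. set m \<subseteq> set l \<and> Suc (length m) = length l}"
  have "finite {m. set m \<subseteq> set l \<and> length m \<le> length l}"
    by (rule finite_lists_length_le) simp
  then have "finite ?M"
    by (rule finite_subset[rotated]) auto
  then have "finite (\<Union>m\<in>?M. {p \<in> s. \<chi> m p \<noteq> \<psi> m p})"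
    using assms unfolding aeq_def by blast
  moreover have "{p \<in> s. cobd (\<lambda>m. \<chi> m p) l \<noteq> cobd (\<lambda>m. \<psi> m p) l}
      \<subseteq> (\<Union>m\<in>?M. {p \<in> s. \<chi> m p \<noteq> \<psi> m p})"
    using cobd_cong[of l "\<lambda>m. \<chi> m p" "\<lambda>m. \<psi> m p" for p] by blast
  ultimately show ?thesis
    unfolding aeq_def by (rule rev_finite_subset)
qed

text \<open>Only lists of length \<open>n\<close> matter for \<open>\<theta>\<close> and lists of length \<open>n + 1\<close> for \<open>\<phi>\<close>, whose value at a list is
  regarded as a function on the intersection of the sets indexed by it.\<close>

definition is_cobd ::
    "'i set \<Rightarrow> ('i \<Rightarrow> 'p set) \<Rightarrow> nat \<Rightarrow> ('i list \<Rightarrow> 'p \<Rightarrow> 'v::ab_group_add) \<Rightarrow> ('i list \<Rightarrow> 'p \<Rightarrow> 'v) \<Rightarrow> bool"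
  where "is_cobd I a n \<theta> \<phi> \<longleftrightarrow> (\<forall>l. length l = Suc n \<and> set l \<subseteq> I \<longrightarrow>
     aeq (\<Inter>i\<in>set l. a i) (\<lambda>p. cobd (\<lambda>m. \<theta> m p) l) (\<phi> l))"

abbreviation cocycle ::
    "'i set \<Rightarrow> ('i \<Rightarrow> 'p set) \<Rightarrow> nat \<Rightarrow> ('i list \<Rightarrow> 'p \<Rightarrow> 'v::ab_group_add) \<Rightarrow> bool"
  where "cocycle I a n \<phi> \<equiv> is_cobd I a n \<phi> (\<lambda>_ _. 0)"

lemma is_cobd_mono: "is_cobd I a n \<theta> \<phi> \<Longrightarrow> J \<subseteq> I \<Longrightarrow> is_cobd J a n \<theta> \<phi>"
  unfolding is_cobd_def by blast

lemma is_cobd_cong: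
  assumes "\<And>l. length l = n \<Longrightarrow> set l \<subseteq> I \<Longrightarrow> \<theta> l = \<theta>' l"
    and "\<And>l. length l = Suc n \<Longrightarrow> set l \<subseteq> I \<Longrightarrow> \<phi> l = \<phi>' l"
  shows "is_cobd I a n \<theta> \<phi> \<longleftrightarrow> is_cobd I a n \<theta>' \<phi>'"
proof -
  have "cobd (\<lambda>m. \<theta> m p) l = cobd (\<lambda>m. \<theta>' m p) l" if "length l = Suc n" "set l \<subseteq> I" for l p
    by (rule cobd_cong) (use that assms(1) in \<open>auto dest: subset_trans\<close>)
  then show ?thesis
    unfolding is_cobd_def using assms(2) by (metis (no_types, lifting) ext)
qed

text \<open>Each instance concerns a single tuple, so the property can be tested on the finite sets
  \<open>set l\<close>. In this form \<open>extension_recursion\<close> can propagate it list by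
  list.\<close>

lemma is_cobd_local:
  "is_cobd K a n \<theta> \<phi> \<longleftrightarrow> (\<forall>l. l \<noteq> [] \<longrightarrow> set l \<subseteq> K \<longrightarrow> is_cobd (set l) a n \<theta> \<phi>)"
proof
  assume *: "\<forall>l. l \<noteq> [] \<longrightarrow> set l \<subseteq> K \<longrightarrow> is_cobd (set l) a n \<theta> \<phi>"
  show "is_cobd K a n \<theta> \<phi>"
    unfolding is_cobd_def
  proof safe
    fix l assume l: "length l = Suc n" "set l \<subseteq> K"
    then have "l \<noteq> []"
      by auto
    then show "aeq (\<Inter> (a ` set l)) (\<lambda>p. cobd (\<lambda>m. \<theta> m p) l) (\<phi> l)"
      using *[rule_format, of l] l unfolding is_cobd_def by simp
  qed
qed (blast intro: is_cobd_mono)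

text \<open>The lists on which \<theta> matters have length \<open>Suc n\<close>, so the value at
  the empty list, about which the recursion says nothing, does not enter.\<close>

lemma is_cobd_cong_nonempty:
  assumes "\<And>m. m \<noteq> [] \<Longrightarrow> set m \<subseteq> K \<Longrightarrow> \<theta> m = \<theta>' m"
  shows "is_cobd K a (Suc n) \<theta> \<phi> \<longleftrightarrow> is_cobd K a (Suc n) \<theta>' \<phi>"
proof (rule is_cobd_cong)
  fix m assume "length m = Suc n" "set m \<subseteq> K"
  then show "\<theta> m = \<theta>' m"
    by (intro assms) auto
qed simp

lemma cocycle_cobd: "cocycle I a n (\<lambda>l p. cobd (\<lambda>m. \<theta> m p) l)"
  unfolding is_cobd_def by (simp add: cobd_cobd)

lemma cocycle_aeq:
  assumes "cocycle I a n \<phi>"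
    and "\<And>l. length l = n \<Longrightarrow> set l \<subseteq> I \<Longrightarrow> aeq (\<Inter>i\<in>set l. a i) (\<psi> l) (\<phi> l)"
  shows "cocycle I a n \<psi>"
  unfolding is_cobd_def
proof safe
  fix l :: "'a list" assume l: "length l = Suc n" "set l \<subseteq> I"
  have "aeq (\<Inter>i\<in>set l. a i) (\<psi> m) (\<phi> m)" if m: "set m \<subseteq> set l" "Suc (length m) = length l" for m
  proof (rule aeq_mono)
    show "aeq (\<Inter>i\<in>set m. a i) (\<psi> m) (\<phi> m)"
      using assms(2) m l by simp
    have "(\<Inter>i\<in>set l. a i) - (\<Inter>i\<in>set m. a i) = {}"
      using m by auto
    then show "finite ((\<Inter>i\<in>set l. a i) - (\<Inter>i\<in>set m. a i))"
      by (simp only: finite.emptyI)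
  qed
  then have "aeq (\<Inter>i\<in>set l. a i) (\<lambda>p. cobd (\<lambda>m. \<psi> m p) l) (\<lambda>p. cobd (\<lambda>m. \<phi> m p) l)"
    by (rule aeq_cobd)
  moreover have "aeq (\<Inter>i\<in>set l. a i) (\<lambda>p. cobd (\<lambda>m. \<phi> m p) l) (\<lambda>_. 0)"
    using assms(1) l unfolding is_cobd_def by blast
  ultimately show "aeq (\<Inter>i\<in>set l. a i) (\<lambda>p. cobd (\<lambda>m. \<psi> m p) l) (\<lambda>_. 0)"
    by (rule aeq_trans)
qed

lemma is_cobd_add:
  assumes "is_cobd I a n \<theta> \<phi>" "is_cobd I a n \<theta>' \<phi>'"
  shows "is_cobd I a n (\<lambda>l p. \<theta> l p + \<theta>' l p) (\<lambda>l p. \<phi> l p + \<phi>' l p)"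
  using assms unfolding is_cobd_def cobd_add by (simp add: aeq_add)

lemma is_cobd_diff:
  assumes "is_cobd I a n \<theta> \<phi>" "is_cobd I a n \<theta>' \<phi>'"
  shows "is_cobd I a n (\<lambda>l p. \<theta> l p - \<theta>' l p) (\<lambda>l p. \<phi> l p - \<phi>' l p)"
  using assms unfolding is_cobd_def cobd_diff by (simp add: aeq_diff)


text \<open>Each point \<open>p\<close> is treated by the cone over the first index whose set contains \<open>p\<close>; on any
  \<open>a j\<close> only finitely many indices occur.\<close>

lemma cocycle_countable:
  assumes "countable I" and \<phi>: "cocycle I a (Suc n) \<phi>"
  shows "\<exists>\<theta>. is_cobd I a n \<theta> \<phi>"
proof -
  define i where "i p = arg_min (to_nat_on I) (\<lambda>j. j \<in> I \<and> p \<in> a j)" for p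
  define \<theta> where "\<theta> l p = \<phi> (i p # l) p" for l p
  have i: "i p \<in> I \<and> p \<in> a (i p) \<and> to_nat_on I (i p) \<le> to_nat_on I j" if "j \<in> I" "p \<in> a j" for p j
    unfolding i_def using arg_min_natI[of "\<lambda>j. j \<in> I \<and> p \<in> a j" j "to_nat_on I"]
      arg_min_nat_le[of "\<lambda>j. j \<in> I \<and> p \<in> a j" j "to_nat_on I"] that by blast
  have "aeq (\<Inter>j\<in>set l. a j) (\<lambda>p. cobd (\<lambda>m. \<theta> m p) l) (\<phi> l)"
    if l: "length l = Suc n" "set l \<subseteq> I" for l
  proof -
    obtain j l' where jl': "l = j # l'"
      using l by (cases l) auto
    let ?J = "{k \<in> I. to_nat_on I k \<le> to_nat_on I j}"
    have "finite ?J"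
    proof (rule finite_imageD[of "to_nat_on I"])
      show "finite (to_nat_on I ` ?J)"
        by (rule finite_subset[of _ "{..to_nat_on I j}"]) auto
      show "inj_on (to_nat_on I) ?J"
        by (rule inj_on_subset[OF inj_on_to_nat_on]) (use assms(1) in auto)
    qed
    moreover have "finite {p \<in> (\<Inter>j\<in>set (k # l). a j). cobd (\<lambda>m. \<phi> m p) (k # l) \<noteq> 0}" if "k \<in> ?J" for k
      using \<phi>[unfolded is_cobd_def aeq_def, rule_format, of "k # l"] l that by auto
    ultimately have "finite (\<Union>k\<in>?J. {p \<in> (\<Inter>j\<in>set (k # l). a j). cobd (\<lambda>m. \<phi> m p) (k # l) \<noteq> 0})"
      by blast
    moreover have "{p \<in> (\<Inter>j\<in>set l. a j). cobd (\<lambda>m. \<theta> m p) l \<noteq> \<phi> l p}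
       \<subseteq> (\<Union>k\<in>?J. {p \<in> (\<Inter>j\<in>set (k # l). a j). cobd (\<lambda>m. \<phi> m p) (k # l) \<noteq> 0})"
    proof safe
      fix p assume p: "p \<in> (\<Inter>j\<in>set l. a j)" "cobd (\<lambda>m. \<theta> m p) l \<noteq> \<phi> l p"
      have "i p \<in> ?J" "p \<in> a (i p)"
        using i[of j p] p(1) l jl' by auto
      \<comment> \<open>By the recursion, \<open>cobd\<close> of \<phi> at \<open>i p # l\<close> is
        \<open>\<phi> l p\<close> minus \<open>cobd\<close> of \<theta> at \<open>l\<close>. A bad
        point of \<theta> is thus a point where the cocycle equation fails for one of finitely many
        lists \<open>k # l\<close>.\<close>
      moreover have "cobd (\<lambda>m. \<phi> m p) (i p # l) \<noteq> 0"
        using p(2) by (simp add: cobd.simps \<theta>_def)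
      ultimately show "p \<in> (\<Union>k\<in>?J. {p \<in> (\<Inter>j\<in>set (k # l). a j). cobd (\<lambda>m. \<phi> m p) (k # l) \<noteq> 0})"
        using p(1) by auto
    qed
    ultimately show ?thesis
      unfolding aeq_def by (rule rev_finite_subset)
  qed
  then show ?thesis
    unfolding is_cobd_def by blast
qed

section \<open>Well-orders and recursion along their initial segments\<close>

lemma underS_insert: "Well_order r \<Longrightarrow> \<alpha> \<in> Field r \<Longrightarrow> under r \<alpha> = insert \<alpha> (underS r \<alpha>)"
  by (simp add: Refl_under_underS order_on_defs)

lemma underS_trans:
  assumes "Well_order r" "\<alpha> \<in> underS r \<beta>" "\<beta> \<in> underS r \<gamma>"
  shows "\<alpha> \<in> underS r \<gamma>"
  using assms unfolding underS_def order_on_defs by (auto dest: transD antisymD)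

lemma under_antisym:
  assumes "Well_order r" "\<alpha> \<in> under r \<beta>" "\<beta> \<in> under r \<alpha>"
  shows "\<alpha> = \<beta>"
proof -
  have "antisym r"
    using assms(1) by (simp add: order_on_defs)
  then show ?thesis
    using assms(2,3) by (auto simp: under_def dest: antisymD)
qed

lemma under_underS_trans:
  assumes "Well_order r" "\<alpha> \<in> under r \<beta>" "\<beta> \<in> underS r \<gamma>"
  shows "\<alpha> \<in> underS r \<gamma>"
  using assms unfolding underS_def under_def order_on_defs by (auto dest: transD antisymD)

lemma well_order_cases:
  assumes "Well_order r" "\<alpha> \<in> Field r" "\<beta> \<in> Field r"
  shows "\<alpha> \<in> underS r \<beta> \<or> \<alpha> = \<beta> \<or> \<beta> \<in> underS r \<alpha>"
  using assms unfolding underS_def order_on_defs total_on_def by blast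

lemma ex_max_list:
  assumes "Well_order r" "set l \<subseteq> Field r" "l \<noteq> []"
  shows "\<exists>\<alpha>\<in>set l. set l \<subseteq> under r \<alpha>"
  using assms(3,2)
proof (induction l rule: list_nonempty_induct)
  case (single x)
  then show ?case
    using underS_insert[OF assms(1), of x] by auto
next
  case (cons x l)
  then obtain \<alpha> where \<alpha>: "\<alpha> \<in> set l" "set l \<subseteq> under r \<alpha>"
    by auto
  then have "x \<in> under r \<alpha> \<or> \<alpha> \<in> underS r x"
    using well_order_cases[OF assms(1), of x \<alpha>] underS_insert[OF assms(1), of \<alpha>] cons.prems by auto
  then show ?case
  proof
    assume "x \<in> under r \<alpha>"
    then show ?case using \<alpha> by auto
  next
    assume "\<alpha> \<in> underS r x"
    then have "set l \<subseteq> underS r x"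
      using \<alpha>(2) under_underS_trans[OF assms(1)] by blast
    then have "set (x # l) \<subseteq> under r x"
      using underS_insert[OF assms(1), of x] cons.prems by auto
    then show ?case by auto
  qed
qed

text \<open>The default 0 lets stage \<alpha> see nothing but values fixed earlier. The empty list
  is blanked too, since it lies in every initial segment and belongs to no stage.\<close>

definition res :: "'i set \<Rightarrow> ('i list \<Rightarrow> 'p \<Rightarrow> 'v::zero) \<Rightarrow> 'i list \<Rightarrow> 'p \<Rightarrow> 'v" where
  "res K \<chi> = (\<lambda>l. if l \<noteq> [] \<and> set l \<subseteq> K then \<chi> l else (\<lambda>_. 0))"

text \<open>A list belongs to the stage of its largest entry \<open>M l\<close>, where
  \<open>E\<close> fixes its value from lists with smaller maxima. Older values are never changed,
  so the equation for \<phi> persists at every later stage. In both applications \<open>R\<close>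
  expresses the equations for lists over \<open>set l\<close>.\<close>

lemma extension_recursion:
  fixes E :: "'i \<Rightarrow> ('i list \<Rightarrow> 'p \<Rightarrow> 'v::zero) \<Rightarrow> 'i list \<Rightarrow> 'p \<Rightarrow> 'v"
  assumes r: "Well_order r"
    and local: "\<And>\<chi> \<chi>' l. (\<And>m. m \<noteq> [] \<Longrightarrow> set m \<subseteq> set l \<Longrightarrow> \<chi> m = \<chi>' m) \<Longrightarrow> R \<chi> l \<Longrightarrow> R \<chi>' l"
    and E_res: "\<And>\<alpha> \<chi> l. \<alpha> \<in> Field r \<Longrightarrow> l \<noteq> [] \<Longrightarrow> set l \<subseteq> underS r \<alpha> \<Longrightarrow> E \<alpha> \<chi> l = \<chi> l"
    and E_good: "\<And>\<alpha> \<chi> l. \<alpha> \<in> Field r \<Longrightarrow> (\<And>l. l \<noteq> [] \<Longrightarrow> set l \<subseteq> underS r \<alpha> \<Longrightarrow> R \<chi> l)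
       \<Longrightarrow> l \<noteq> [] \<Longrightarrow> set l \<subseteq> under r \<alpha> \<Longrightarrow> R (E \<alpha> \<chi>) l"
  shows "\<exists>\<phi>. (\<forall>\<alpha>\<in>Field r. \<forall>l. l \<noteq> [] \<longrightarrow> set l \<subseteq> under r \<alpha> \<longrightarrow> \<phi> l = E \<alpha> (res (underS r \<alpha>) \<phi>) l)
     \<and> (\<forall>l. l \<noteq> [] \<longrightarrow> set l \<subseteq> Field r \<longrightarrow> R \<phi> l)"
proof -
  define M where "M l = (SOME \<alpha>. \<alpha> \<in> set l \<and> set l \<subseteq> under r \<alpha>)" for l
  have M: "M l \<in> set l \<and> set l \<subseteq> under r (M l)" if "l \<noteq> []" "set l \<subseteq> Field r" for l
    unfolding M_def using ex_max_list[OF r that(2,1)] someI_ex[of "\<lambda>\<alpha>. \<alpha> \<in> set l \<and> set l \<subseteq> under r \<alpha>"]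
    by blast
  define W where "W = inv_image (r - Id) M"
  have wf: "wf W"
    unfolding W_def using r by (simp add: well_order_on_def)
  define H where "H f l = E (M l) (res (underS r (M l)) f) l" for f l
  define \<phi> where "\<phi> = wfrec W H"
  have \<phi>_M: "\<phi> l = E (M l) (res (underS r (M l)) \<phi>) l" if l: "l \<noteq> []" "set l \<subseteq> Field r" for l
  proof -
    have "\<phi> l = H (cut \<phi> W l) l"
      unfolding \<phi>_def by (rule wfrec[OF wf])
    moreover have "res (underS r (M l)) (cut \<phi> W l) = res (underS r (M l)) \<phi>"
    proof
      fix m
      show "res (underS r (M l)) (cut \<phi> W l) m = res (underS r (M l)) \<phi> m"
      proof (cases "m \<noteq> [] \<and> set m \<subseteq> underS r (M l)")
        case True
        then have "set m \<subseteq> Field r"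
          using Order_Relation.underS_Field[of r "M l"] by auto
        then have "M m \<in> underS r (M l)"
          using M[of m] True by auto
        then have "(m, l) \<in> W"
          unfolding W_def underS_def by auto
        then show ?thesis
          by (simp add: res_def cut_apply)
      qed (auto simp: res_def)
    qed
    ultimately show ?thesis
      by (simp add: H_def)
  qed
  have \<phi>: "\<phi> l = E \<alpha> (res (underS r \<alpha>) \<phi>) l"
    if \<alpha>: "\<alpha> \<in> Field r" and l: "l \<noteq> []" "set l \<subseteq> under r \<alpha>" for \<alpha> l
  proof (cases "set l \<subseteq> underS r \<alpha>")
    case True
    then show ?thesis
      using E_res[OF \<alpha> l(1) True, of "res (underS r \<alpha>) \<phi>"] l by (simp add: res_def)
  next
    case False
    then have "\<alpha> \<in> set l"
      using l underS_insert[OF r \<alpha>] by auto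
    have "set l \<subseteq> Field r"
      using subset_trans[OF l(2) under_Field] .
    then have "M l \<in> under r \<alpha>" "\<alpha> \<in> under r (M l)"
      using M[OF l(1)] l(2) \<open>\<alpha> \<in> set l\<close> by auto
    then have "M l = \<alpha>"
      by (rule under_antisym[OF r])
    then show ?thesis
      using \<phi>_M[OF l(1) \<open>set l \<subseteq> Field r\<close>] by simp
  qed
  have good: "R \<phi> l" if "\<alpha> \<in> Field r" "l \<noteq> []" "set l \<subseteq> under r \<alpha>" for \<alpha> l
    using that
  proof (induction \<alpha> arbitrary: l rule: wf_induct[of "r - Id"])
    case 1
    show ?case using r by (simp add: well_order_on_def)
  next
    case (2 \<alpha>)
    have "R (E \<alpha> (res (underS r \<alpha>) \<phi>)) l"
    proof (rule E_good[OF 2(2) _ 2(3,4)])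
      fix m assume m: "m \<noteq> []" "set m \<subseteq> underS r \<alpha>"
      then have m': "set m \<subseteq> Field r"
        using Order_Relation.underS_Field[of r \<alpha>] by auto
      have "M m \<in> underS r \<alpha>"
        using M[OF m(1) m'] m(2) by auto
      then have "R \<phi> m"
        using 2(1) M[OF m(1) m'] m' m(1) unfolding underS_def by auto
      then show "R (res (underS r \<alpha>) \<phi>) m"
        by (rule local[rotated]) (use m in \<open>auto simp: res_def\<close>)
    qed
    then show ?case
      by (rule local[rotated]) (use \<phi>[OF 2(2)] 2(4) in auto)
  qed
  have "R \<phi> l" if l: "l \<noteq> []" "set l \<subseteq> Field r" for l
    using good[of "M l" l] M[OF l] l by auto
  with \<phi> show ?thesis
    by blast
qed

section \<open>The alephs, and triviality of cocycles in high degrees\<close>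

lemma is_aleph_Card_order: "is_aleph k r \<Longrightarrow> Card_order r"
  by (cases k) auto

lemma is_aleph_infinite: "is_aleph k r \<Longrightarrow> infinite (Field r)"
proof (induction k arbitrary: r)
  case 0
  then show ?case
    using Cinfinite_cong[OF ordIso_symmetric, of r natLeq] natLeq_Cinfinite by (auto simp: cinfinite_def)
next
  case (Suc k)
  then obtain s :: "'a rel" where s: "is_aleph k s" "r =o cardSuc s"
    by auto
  then have "Cinfinite s"
    using Suc.IH is_aleph_Card_order by (auto simp: cinfinite_def)
  then have "Cinfinite r"
    using Cinfinite_cong[OF ordIso_symmetric[OF s(2)]] Cinfinite_cardSuc by blast
  then show ?case
    by (simp add: cinfinite_def)
qed

lemma is_aleph_Cinfinite: "is_aleph k r \<Longrightarrow> Cinfinite r"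
  using is_aleph_infinite is_aleph_Card_order by (auto simp: cinfinite_def)

lemma finite_ordLeq_Cinfinite:
  assumes "finite A" "Cinfinite r"
  shows "|A| \<le>o r"
proof -
  have "|A| <o |Field r|"
    using assms by (intro finite_ordLess_infinite) (auto simp: cinfinite_def Field_card_of card_of_well_order_on)
  moreover have "|Field r| =o r"
    using assms card_of_Field_ordIso by blast
  ultimately show ?thesis
    using ordLess_ordIso_trans ordLess_imp_ordLeq by blast
qed

lemma is_aleph_unique:
  fixes r :: "'a rel" and s :: "'b rel"
  shows "is_aleph k r \<Longrightarrow> is_aleph k s \<Longrightarrow> r =o s"
proof (induction k arbitrary: r s)
  case 0
  then show ?case
    using ordIso_symmetric ordIso_transitive by (metis is_aleph.simps(1))
next
  case (Suc k)
  then obtain r' :: "'a rel" and s' :: "'b rel"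
    where *: "is_aleph k r'" "r =o cardSuc r'" "is_aleph k s'" "s =o cardSuc s'"
    unfolding is_aleph.simps by blast
  then have "cardSuc r' =o cardSuc s'"
    using Suc.IH is_aleph_Card_order by (metis cardSuc_invar_ordIso)
  then show ?case
    by (rule ordIso_transitive[OF *(2) ordIso_transitive[OF _ ordIso_symmetric[OF *(4)]]])
qed

lemma is_aleph_Suc_ordLess:
  assumes "is_aleph (Suc k) (r :: 'a rel)" "is_aleph k (s :: 'a rel)" "Card_order t"
  shows "t <o r \<longleftrightarrow> t \<le>o s"
proof -
  obtain s' :: "'a rel" where s': "is_aleph k s'" "r =o cardSuc s'"
    using assms by auto
  have "s' =o s"
    using s' assms is_aleph_unique by blast
  have "t <o r \<longleftrightarrow> t <o cardSuc s'"
    by (intro iffI) (erule ordLess_ordIso_trans, simp add: s' ordIso_symmetric)+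
  also have "\<dots> \<longleftrightarrow> t \<le>o s'"
    using assms s' is_aleph_Card_order by (metis cardSuc_ordLeq_ordLess)
  also have "\<dots> \<longleftrightarrow> t \<le>o s"
    using \<open>s' =o s\<close> ordIso_symmetric ordLeq_ordIso_trans by blast
  finally show ?thesis .
qed

text \<open>Solutions on initial segments are extended along a well-order of \<open>I\<close>: two solutions on an initial
  segment differ by a cocycle of lower degree, hence by a coboundary, which extends by zero.\<close>

lemma cocycle_is_cobd:
  fixes s :: "'a rel" and I :: "'i set" and \<phi> :: "'i list \<Rightarrow> 'p \<Rightarrow> 'v::ab_group_add"
  assumes "is_aleph k s" "|I| \<le>o s" "k \<le> n" "cocycle I a (Suc n) \<phi>"
  shows "\<exists>\<theta>. is_cobd I a n \<theta> \<phi>"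
  using assms
proof (induction k arbitrary: s n I \<phi>)
  case 0
  then have "|I| \<le>o natLeq"
    using ordLeq_ordIso_trans by (metis is_aleph.simps(1))
  then have "|I| \<le>o |UNIV :: nat set|"
    using card_of_nat ordIso_symmetric ordLeq_ordIso_trans by blast
  then have "countable I"
    using card_of_ordLeq[of I "UNIV :: nat set"] by (auto simp: countable_def)
  then show ?case
    by (rule cocycle_countable) (rule 0)
next
  case (Suc k)
  \<comment> \<open>Passing to the next cardinal costs one degree: the difference of two solutions
    is trivialized, over an index set of the smaller size, in degree \<open>n'\<close>.\<close>
  obtain n' where n: "n = Suc n'" "k \<le> n'"
    using Suc.prems(3) by (cases n) auto
  obtain s' :: "'a rel" where s': "is_aleph k s'"
    using Suc.prems(1) by auto
  define r where "r = |I|"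
  have r: "Well_order r" "Field r = I" "Card_order r"
    unfolding r_def by (rule card_of_Well_order Field_card_of card_of_Card_order)+
  have small: "|under r \<alpha>| \<le>o s'" if "\<alpha> \<in> I" for \<alpha>
  proof -
    have "|underS r \<alpha>| <o r"
      using that r card_of_underS by auto
    then have "|underS r \<alpha>| <o s"
      using Suc.prems(2) ordLess_ordLeq_trans unfolding r_def by blast
    then have le: "|underS r \<alpha>| \<le>o s'"
      using is_aleph_Suc_ordLess[OF Suc.prems(1) s'] card_of_Card_order by blast
    have "|{\<alpha>}| \<le>o s'"
      using is_aleph_Cinfinite[OF s'] by (rule finite_ordLeq_Cinfinite[rotated]) simp
    then have "|{\<alpha>} \<union> underS r \<alpha>| \<le>o s'"
      using le is_aleph_Cinfinite[OF s'] card_of_Un_ordLeq_infinite_Field[of s' "{\<alpha>}" "underS r \<alpha>"]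
      by (auto simp: cinfinite_def)
    then show ?thesis
      using underS_insert[OF r(1), of \<alpha>] that r(2) by simp
  qed
  have restr: "cocycle K a (Suc n) \<phi>" if "K \<subseteq> I" for K
    by (rule is_cobd_mono[OF Suc.prems(4) that])
  have step: "\<exists>\<theta>'. (\<forall>l. l \<noteq> [] \<longrightarrow> set l \<subseteq> underS r \<alpha> \<longrightarrow> \<theta>' l = \<theta> l)
        \<and> (is_cobd (underS r \<alpha>) a n \<theta> \<phi> \<longrightarrow> is_cobd (under r \<alpha>) a n \<theta>' \<phi>)"
    if \<alpha>: "\<alpha> \<in> I" for \<alpha> \<theta>
  proof (cases "is_cobd (underS r \<alpha>) a n \<theta> \<phi>")
    case True
    have "|underS r \<alpha>| \<le>o s'"
      by (rule ordLeq_transitive[OF card_of_mono1[OF underS_subset_under] small[OF \<alpha>]])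
    obtain \<eta> where \<eta>: "is_cobd (under r \<alpha>) a n \<eta> \<phi>"
      using Suc.IH[OF s' small[OF \<alpha>], of n] restr[of "under r \<alpha>"] n under_Field[of r \<alpha>] r(2) by auto
    have "cocycle (underS r \<alpha>) a (Suc n') (\<lambda>l p. \<theta> l p - \<eta> l p)"
      using is_cobd_diff[OF True is_cobd_mono[OF \<eta> underS_subset_under]] n(1) by simp
    then obtain u where u: "is_cobd (underS r \<alpha>) a n' u (\<lambda>l p. \<theta> l p - \<eta> l p)"
      using Suc.IH[OF s' \<open>|underS r \<alpha>| \<le>o s'\<close> n(2)] by blast
    \<comment> \<open>Old values are kept exactly, not just modulo finite sets, because the
      recursion builds one cochain. At lists through \<alpha> any values of \<open>u\<close> will
      do: only the vanishing of the double coboundary is used.\<close>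
    define \<theta>' where "\<theta>' l = (if set l \<subseteq> underS r \<alpha> then \<theta> l else (\<lambda>p. \<eta> l p + cobd (\<lambda>m. u m p) l))" for l
    have "cocycle (under r \<alpha>) a n (\<lambda>l p. \<theta>' l p - \<eta> l p)"
    proof (rule cocycle_aeq[OF cocycle_cobd[of _ _ _ u]])
      fix l assume "length l = n" "set l \<subseteq> under r \<alpha>"
      then show "aeq (\<Inter> (a ` set l)) (\<lambda>p. \<theta>' l p - \<eta> l p) (\<lambda>p. cobd (\<lambda>m. u m p) l)"
        using u n(1) by (auto simp: \<theta>'_def is_cobd_def intro: aeq_sym)
    qed
    from is_cobd_add[OF this \<eta>] have "is_cobd (under r \<alpha>) a n \<theta>' \<phi>"
      by simp
    then show ?thesis
      by (intro exI[of _ \<theta>']) (auto simp: \<theta>'_def)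
  qed auto
  define E where "E \<alpha> \<theta> = (SOME \<theta>'. (\<forall>l. l \<noteq> [] \<longrightarrow> set l \<subseteq> underS r \<alpha> \<longrightarrow> \<theta>' l = \<theta> l)
        \<and> (is_cobd (underS r \<alpha>) a n \<theta> \<phi> \<longrightarrow> is_cobd (under r \<alpha>) a n \<theta>' \<phi>))" for \<alpha> \<theta>
  have E: "(\<forall>l. l \<noteq> [] \<longrightarrow> set l \<subseteq> underS r \<alpha> \<longrightarrow> E \<alpha> \<theta> l = \<theta> l)
        \<and> (is_cobd (underS r \<alpha>) a n \<theta> \<phi> \<longrightarrow> is_cobd (under r \<alpha>) a n (E \<alpha> \<theta>) \<phi>)" if "\<alpha> \<in> I" for \<alpha> \<theta>
    unfolding E_def by (rule someI_ex[OF step[OF that]])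
  have "\<exists>\<theta>. (\<forall>\<alpha>\<in>Field r. \<forall>l. l \<noteq> [] \<longrightarrow> set l \<subseteq> under r \<alpha> \<longrightarrow> \<theta> l = E \<alpha> (res (underS r \<alpha>) \<theta>) l)
     \<and> (\<forall>l. l \<noteq> [] \<longrightarrow> set l \<subseteq> Field r \<longrightarrow> is_cobd (set l) a n \<theta> \<phi>)"
  proof (rule extension_recursion[OF r(1)])
    fix \<chi> \<chi>' :: "'i list \<Rightarrow> 'p \<Rightarrow> 'v" and l :: "'i list"
    assume *: "\<And>m. m \<noteq> [] \<Longrightarrow> set m \<subseteq> set l \<Longrightarrow> \<chi> m = \<chi>' m" and "is_cobd (set l) a n \<chi> \<phi>"
    then show "is_cobd (set l) a n \<chi>' \<phi>"
      using is_cobd_cong_nonempty[of "set l" \<chi> \<chi>' a n' \<phi>] n(1) by blast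
  next
    fix \<alpha> \<chi> and l :: "'i list" assume "\<alpha> \<in> Field r" "l \<noteq> []" "set l \<subseteq> underS r \<alpha>"
    then show "E \<alpha> \<chi> l = \<chi> l"
      using E r(2) by blast
  next
    fix \<alpha> \<chi> and l :: "'i list" assume *: "\<alpha> \<in> Field r" "l \<noteq> []" "set l \<subseteq> under r \<alpha>"
      and "\<And>l. l \<noteq> [] \<Longrightarrow> set l \<subseteq> underS r \<alpha> \<Longrightarrow> is_cobd (set l) a n \<chi> \<phi>"
    then have "is_cobd (underS r \<alpha>) a n \<chi> \<phi>"
      using is_cobd_local[of "underS r \<alpha>" a n \<chi> \<phi>] by blast
    then have "is_cobd (under r \<alpha>) a n (E \<alpha> \<chi>) \<phi>"
      using E *(1) r(2) by blast
    then show "is_cobd (set l) a n (E \<alpha> \<chi>) \<phi>"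
      using is_cobd_mono *(3) by blast
  qed
  then show ?case
    using is_cobd_local[of I a n _ \<phi>] r(2) by blast
qed

section \<open>Clubs, cofinal sequences and coding for the weak diamond\<close>

lemma is_aleph_Well_order: "is_aleph k r \<Longrightarrow> Well_order r"
  using is_aleph_Card_order card_order_on_well_order_on by blast

lemma countable_ordLeq_Cinfinite:
  assumes "countable A" "Cinfinite r"
  shows "|A| \<le>o r"
proof -
  have "|A| \<le>o |UNIV :: nat set|"
    using assms(1) card_of_ordLeq[of A "UNIV :: nat set"] by (auto simp: countable_def)
  also have "|UNIV :: nat set| \<le>o |Field r|"
    using assms(2) infinite_iff_card_of_nat[of "Field r"] by (simp add: cinfinite_def)
  also have "|Field r| =o r"
    using assms(2) card_of_Field_ordIso by auto
  finally show ?thesis .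
qed

lemma card_of_lists_ordLeq:
  assumes "|A| \<le>o r" "Cinfinite r"
  shows "|lists A| \<le>o r"
proof -
  have "|{l \<in> lists A. length l = n}| \<le>o r" for n
  proof (induction n)
    case 0
    have "{l \<in> lists A. length l = 0} = {[]}"
      by auto
    then show ?case
      using finite_ordLeq_Cinfinite[OF _ assms(2), of "{[]}"] by simp
  next
    case (Suc n)
    have "{l \<in> lists A. length l = Suc n} \<subseteq> (\<lambda>(x, l). x # l) ` (A \<times> {l \<in> lists A. length l = n})"
      by (auto simp: length_Suc_conv image_iff)
    then have "|{l \<in> lists A. length l = Suc n}| \<le>o |A \<times> {l \<in> lists A. length l = n}|"
      using ordLeq_transitive[OF card_of_mono1 card_of_image] by blast
    also have "|A \<times> {l \<in> lists A. length l = n}| \<le>o r"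
      using card_of_Times_ordLeq_infinite_Field[OF _ assms(1) Suc.IH] assms(2)
      by (simp add: cinfinite_def)
    finally show ?case .
  qed
  moreover have "|UNIV :: nat set| \<le>o r"
    by (rule countable_ordLeq_Cinfinite[OF _ assms(2)]) simp
  ultimately have "|\<Union>n. {l \<in> lists A. length l = n}| \<le>o r"
    using assms(2) by (intro card_of_UNION_ordLeq_infinite_Field) (auto simp: cinfinite_def)
  moreover have "lists A = (\<Union>n. {l \<in> lists A. length l = n})"
    by auto
  ultimately show ?thesis
    by simp
qed

section \<open>Regularity and clubs in successor alephs\<close>

lemma underS_ordLeq:
  assumes "is_aleph (Suc k) (r :: 'a rel)" "is_aleph k (s :: 'a rel)" "\<alpha> \<in> Field r"
  shows "|underS r \<alpha>| \<le>o s" "|under r \<alpha>| \<le>o s"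
proof -
  have r: "Card_order r" "Well_order r"
    by (rule is_aleph_Card_order[OF assms(1)] is_aleph_Well_order[OF assms(1)])+
  show *: "|underS r \<alpha>| \<le>o s"
    by (rule is_aleph_Suc_ordLess[OF assms(1,2) card_of_Card_order, THEN iffD1,
        OF card_of_underS[OF r(1) assms(3)]])
  have "|{\<alpha>}| \<le>o s"
    using is_aleph_Cinfinite[OF assms(2)] by (rule finite_ordLeq_Cinfinite[rotated]) simp
  then show "|under r \<alpha>| \<le>o s"
    using * is_aleph_Cinfinite[OF assms(2)] card_of_Un_ordLeq_infinite_Field[of s "{\<alpha>}" "underS r \<alpha>"]
      underS_insert[OF r(2) assms(3)] by (auto simp: cinfinite_def)
qed

text \<open>This is regularity of a successor cardinal: a set without a strict upper bound is
  cofinal, hence of full size.\<close>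

lemma is_aleph_Suc_bounded:
  assumes r: "is_aleph (Suc k) (r :: 'a rel)" and A: "A \<subseteq> Field r" "|A| <o r"
  shows "\<exists>b\<in>Field r. A \<subseteq> underS r b"
proof (rule ccontr)
  assume *: "\<not> ?thesis"
  obtain s :: "'a rel" where s: "is_aleph k s" "r =o cardSuc s"
    using r by auto
  have "Cinfinite s"
    by (rule is_aleph_Cinfinite[OF s(1)])
  then have reg: "regularCard r"
    using regularCard_ordIso[OF ordIso_symmetric[OF s(2)]] Cinfinite_cardSuc regularCard_cardSuc by auto
  have wo: "Well_order r"
    by (rule is_aleph_Well_order[OF r])
  have "cofinal A r"
    unfolding cofinal_def
  proof
    fix a assume a: "a \<in> Field r"
    then obtain b where b: "b \<in> Field r" "a \<noteq> b" "(a, b) \<in> r"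
      using infinite_Card_order_limit[OF is_aleph_Card_order[OF r] is_aleph_infinite[OF r]] by blast
    then obtain c where c: "c \<in> A" "c \<notin> underS r b"
      using * by blast
    have "a \<in> underS r b"
      using b by (simp add: underS_def)
    moreover have "b = c \<or> b \<in> underS r c"
      using well_order_cases[OF wo, of b c] b c A by auto
    ultimately have "a \<in> underS r c"
      using underS_trans[OF wo] by auto
    then show "\<exists>b\<in>A. a \<noteq> b \<and> (a, b) \<in> r"
      using c by (auto simp: underS_def)
  qed
  then have "|A| =o r"
    using reg A(1) unfolding regularCard_def by simp
  then show False
    using A(2) not_ordLess_ordIso by blast
qed

lemma well_order_least:
  assumes "Well_order r" "A \<subseteq> Field r" "A \<noteq> {}"
  shows "\<exists>a\<in>A. \<forall>b\<in>underS r a. b \<notin> A"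
proof -
  have "wf (r - Id)"
    using assms(1) by (simp add: well_order_on_def)
  then obtain a where "a \<in> A" "\<And>b. (b, a) \<in> r - Id \<Longrightarrow> b \<notin> A"
    using wfE_min'[OF _ assms(3)] by metis
  then show ?thesis
    unfolding underS_def by (intro bexI[of _ a]) auto
qed

lemma underS_inj:
  assumes "Well_order r" "\<alpha> \<in> Field r" "\<beta> \<in> Field r" "underS r \<alpha> = underS r \<beta>"
  shows "\<alpha> = \<beta>"
  using well_order_cases[OF assms(1-3)] assms(4) by (metis underS_notIn)

text \<open>For unboundedness, \<open>N \<beta>\<close> lies above \<beta> and above
  \<open>G\<close> on the whole segment up to \<beta>. The least strict upper bound of the iterates
  of \<open>N\<close> is then closed under \<open>G\<close>, and it exists because countably many
  points are bounded.\<close>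

lemma closure_points_club:
  assumes r: "is_aleph (Suc k) (r :: 'a rel)" and G: "\<And>\<beta>. \<beta> \<in> Field r \<Longrightarrow> G \<beta> \<in> Field r"
  shows "club r {\<alpha> \<in> Field r. \<forall>\<beta>\<in>underS r \<alpha>. G \<beta> \<in> underS r \<alpha>}" (is "club r ?C")
  unfolding club_def
proof (intro conjI ballI impI)
  have wo: "Well_order r"
    by (rule is_aleph_Well_order[OF r])
  obtain s :: "'a rel" where s: "is_aleph k s"
    using r by auto
  have small: "|A| <o r" if "|A| \<le>o s" for A :: "'a set"
    using that is_aleph_Suc_ordLess[OF r s card_of_Card_order] by blast
  show "?C \<subseteq> Field r"
    by auto
  show "\<exists>c\<in>?C. (\<alpha>, c) \<in> r" if \<alpha>: "\<alpha> \<in> Field r" for \<alpha>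
  proof -
    have step: "\<exists>\<gamma>. \<gamma> \<in> Field r \<and> insert \<beta> (G ` under r \<beta>) \<subseteq> underS r \<gamma>" if \<beta>: "\<beta> \<in> Field r" for \<beta>
    proof -
      have "|G ` under r \<beta>| \<le>o s"
        by (rule ordLeq_transitive[OF card_of_image underS_ordLeq(2)[OF r s \<beta>]])
      moreover have "|{\<beta>}| \<le>o s"
        by (rule finite_ordLeq_Cinfinite[OF _ is_aleph_Cinfinite[OF s]]) simp
      ultimately have "|{\<beta>} \<union> G ` under r \<beta>| \<le>o s"
        using is_aleph_Cinfinite[OF s] card_of_Un_ordLeq_infinite_Field
        by (auto simp: cinfinite_def simp del: Un_insert_left)
      then show ?thesis
        using is_aleph_Suc_bounded[OF r _ small, of "insert \<beta> (G ` under r \<beta>)"] \<beta> G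
          under_Field[of r \<beta>] by auto
    qed
    define N where "N = (\<lambda>\<beta>. SOME \<gamma>. \<gamma> \<in> Field r \<and> insert \<beta> (G ` under r \<beta>) \<subseteq> underS r \<gamma>)"
    have N: "N \<beta> \<in> Field r \<and> insert \<beta> (G ` under r \<beta>) \<subseteq> underS r (N \<beta>)" if "\<beta> \<in> Field r" for \<beta>
      unfolding N_def by (rule someI_ex[OF step[OF that]])
    define q where "q n = (N ^^ n) \<alpha>" for n
    have q: "q n \<in> Field r" for n
      by (induction n) (auto simp: q_def \<alpha> N)
    have "|range q| \<le>o s"
      by (rule countable_ordLeq_Cinfinite[OF _ is_aleph_Cinfinite[OF s]]) simp
    then have "{b \<in> Field r. range q \<subseteq> underS r b} \<noteq> {}"
      using is_aleph_Suc_bounded[OF r _ small, of "range q"] q by auto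
    then obtain \<gamma> where \<gamma>: "\<gamma> \<in> Field r" "range q \<subseteq> underS r \<gamma>"
      and least: "\<And>\<beta>. \<beta> \<in> underS r \<gamma> \<Longrightarrow> \<not> (\<beta> \<in> Field r \<and> range q \<subseteq> underS r \<beta>)"
      using well_order_least[OF wo, of "{b \<in> Field r. range q \<subseteq> underS r b}"] by auto
    have "G \<beta> \<in> underS r \<gamma>" if \<beta>: "\<beta> \<in> underS r \<gamma>" for \<beta>
    proof -
      have \<beta>F: "\<beta> \<in> Field r"
        using \<beta> Order_Relation.underS_Field[of r \<gamma>] by auto
      then obtain n where "q n \<notin> underS r \<beta>"
        using least[OF \<beta>] by auto
      then have "\<beta> \<in> under r (q n)"
        using well_order_cases[OF wo, of \<beta> "q n"] underS_insert[OF wo, of "q n"] q[of n] \<beta>F by auto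
      then have "G \<beta> \<in> underS r (q (Suc n))"
        using N[OF q[of n]] by (auto simp: q_def)
      then show ?thesis
        using underS_trans[OF wo, of "G \<beta>" "q (Suc n)" \<gamma>] \<gamma>(2) by auto
    qed
    moreover have "\<alpha> \<in> underS r \<gamma>"
      using subsetD[OF \<gamma>(2) rangeI[of q 0]] by (simp add: q_def)
    ultimately show ?thesis
      using \<gamma>(1) by (auto simp: underS_def)
  qed
  show "\<alpha> \<in> ?C" if \<alpha>: "\<alpha> \<in> Field r"
    and lim: "underS r \<alpha> \<noteq> {} \<and> (\<forall>b\<in>underS r \<alpha>. \<exists>c\<in>?C \<inter> underS r \<alpha>. b \<in> underS r c)" for \<alpha>
  proof -
    have "G \<beta> \<in> underS r \<alpha>" if "\<beta> \<in> underS r \<alpha>" for \<beta>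
      using lim that underS_trans[OF wo] by blast
    then show ?thesis
      using \<alpha> by auto
  qed
qed

section \<open>Coding cochains below a closure point\<close>

lemma list_in_UN_underS:
  assumes "Well_order r" "underS r \<alpha> \<noteq> {}" "set l \<subseteq> (\<Union>i\<in>underS r \<alpha>. B i)"
  shows "\<exists>\<beta>\<in>underS r \<alpha>. set l \<subseteq> (\<Union>i\<in>under r \<beta>. B i)"
  using assms(3)
proof (induction l)
  case Nil
  then show ?case using assms(2) by auto
next
  case (Cons x l)
  then obtain \<beta> i where *: "\<beta> \<in> underS r \<alpha>" "set l \<subseteq> (\<Union>i\<in>under r \<beta>. B i)" "i \<in> underS r \<alpha>" "x \<in> B i"
    by auto
  have F: "\<beta> \<in> Field r" "i \<in> Field r"
    using * Order_Relation.underS_Field[of r \<alpha>] by auto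
  show ?case
  proof (cases "i \<in> under r \<beta>")
    case True
    then show ?thesis using * by auto
  next
    case False
    then have "\<beta> \<in> underS r i"
      using well_order_cases[OF assms(1) F] underS_insert[OF assms(1) F(1)] by auto
    then have "under r \<beta> \<subseteq> under r i"
      using under_underS_trans[OF assms(1)] underS_subset_under[of r i] by blast
    moreover have "i \<in> under r i"
      using underS_insert[OF assms(1) F(2)] by simp
    ultimately have "set (x # l) \<subseteq> (\<Union>i\<in>under r i. B i)"
      using * by fastforce
    then show ?thesis
      using *(3) by blast
  qed
qed

text \<open>The weak diamond speaks of functions to 2, so \<open>Y\<close> is replaced by the
  characteristic function of its graph, moved into \<open>Field r\<close> by an injection
  \<open>e\<close>. Each stage adds at most \<open>\<aleph>\<^sub>k\<close> entries, and points and
  values are countable, so there is a club of \<alpha> for which all triples built from stages below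
  \<alpha> have codes below \<alpha>. There the restricted characteristic function determines
  \<open>Y\<close> on the lists concerned.\<close>

lemma weak_diamond_lists:
  fixes r :: "'a rel" and B :: "'a \<Rightarrow> 'b set"
    and F :: "'a \<Rightarrow> ('b list \<Rightarrow> 'p::countable \<Rightarrow> 'v::{countable, zero}) \<Rightarrow> bool"
  assumes r: "is_aleph (Suc k) r" and s: "is_aleph k (s :: 'a rel)" and wd: "weak_diamond r S"
    and S: "\<And>\<alpha>. \<alpha> \<in> S \<Longrightarrow> \<alpha> \<in> Field r \<and> underS r \<alpha> \<noteq> {}"
    and B: "\<And>i. i \<in> Field r \<Longrightarrow> |B i| \<le>o s"
  shows "\<exists>g :: 'a \<Rightarrow> bool. \<forall>Y. \<exists>\<alpha>\<in>S.
    g \<alpha> = F \<alpha> (\<lambda>l. if set l \<subseteq> (\<Union>i\<in>underS r \<alpha>. B i) then Y l else (\<lambda>_. 0))"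
proof -
  have wo: "Well_order r" and Cr: "Cinfinite r" and Cs: "Cinfinite s"
    by (rule is_aleph_Well_order[OF r] is_aleph_Cinfinite[OF r] is_aleph_Cinfinite[OF s])+
  have sr: "s \<le>o r"
    using is_aleph_Suc_ordLess[OF r s is_aleph_Card_order[OF s]]
      ordLeq_reflexive[OF is_aleph_Well_order[OF s]] by (intro ordLess_imp_ordLeq) simp
  define T where "T K = lists (\<Union>i\<in>K. B i) \<times> (UNIV :: 'p set) \<times> (UNIV :: 'v set)" for K
  have T: "|T K| \<le>o t" if "Cinfinite t" "|K| \<le>o t" "s \<le>o t" "K \<subseteq> Field r" for K and t :: "'a rel"
  proof -
    have "\<forall>i\<in>K. |B i| \<le>o t"
      using B that(3,4) ordLeq_transitive by blast
    then have "|\<Union>i\<in>K. B i| \<le>o t"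
      using that(1,2) by (intro card_of_UNION_ordLeq_infinite_Field) (auto simp: cinfinite_def)
    then have "|lists (\<Union>i\<in>K. B i)| \<le>o t"
      by (rule card_of_lists_ordLeq[OF _ that(1)])
    moreover have "|UNIV :: ('p \<times> 'v) set| \<le>o t"
      by (rule countable_ordLeq_Cinfinite[OF _ that(1)]) simp
    ultimately show ?thesis
      unfolding T_def UNIV_Times_UNIV using that(1)
      by (intro card_of_Times_ordLeq_infinite_Field) (auto simp: cinfinite_def)
  qed
  have "|T (Field r)| \<le>o |Field r|"
  proof (rule ordLeq_ordIso_trans)
    have "r =o |Field r|"
      using Cr card_of_Field_ordIso ordIso_symmetric by blast
    then show "r =o |Field r|" .
    show "|T (Field r)| \<le>o r"
      using T[of r "Field r"] Cr sr card_of_Field_ordIso[of r] ordIso_imp_ordLeq by blast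
  qed
  then obtain e where e: "inj_on e (T (Field r))" "e ` T (Field r) \<subseteq> Field r"
    using card_of_ordLeq[of "T (Field r)" "Field r"] by auto
  have T_mono: "T K \<subseteq> T K'" if "K \<subseteq> K'" for K K'
    unfolding T_def by (intro Sigma_mono lists_mono UN_mono) (use that in auto)
  have "\<exists>b. b \<in> Field r \<and> e ` T (under r \<beta>) \<subseteq> underS r b" if \<beta>: "\<beta> \<in> Field r" for \<beta>
  proof -
    have "|T (under r \<beta>)| \<le>o s"
      by (rule T[OF Cs underS_ordLeq(2)[OF r s \<beta>]]) (use ordLeq_reflexive[OF is_aleph_Well_order[OF s]] under_Field[of r \<beta>] in auto)
    then have "|e ` T (under r \<beta>)| \<le>o s"
      using ordLeq_transitive[OF card_of_image] by blast
    then have "|e ` T (under r \<beta>)| <o r"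
      using is_aleph_Suc_ordLess[OF r s card_of_Card_order] by blast
    then show ?thesis
      using is_aleph_Suc_bounded[OF r, of "e ` T (under r \<beta>)"] e(2) T_mono[OF under_Field[of r \<beta>]]
      by blast
  qed
  then obtain G where G: "\<And>\<beta>. \<beta> \<in> Field r \<Longrightarrow> G \<beta> \<in> Field r"
    and eG: "\<And>\<beta>. \<beta> \<in> Field r \<Longrightarrow> e ` T (under r \<beta>) \<subseteq> underS r (G \<beta>)"
    by metis
  define C where "C = {\<alpha> \<in> Field r. \<forall>\<beta>\<in>underS r \<alpha>. G \<beta> \<in> underS r \<alpha>}"
  have C: "club r C"
    unfolding C_def by (rule closure_points_club[OF r G])
  define code where "code Y b \<longleftrightarrow> (\<exists>l q. set l \<subseteq> (\<Union>i\<in>Field r. B i) \<and> b = e (l, q, Y l q))"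
    for Y :: "'b list \<Rightarrow> 'p \<Rightarrow> 'v" and b
  \<comment> \<open>For \<alpha> in \<open>C\<close> and \<open>h\<close> coming from
    \<open>Y\<close>, every candidate \<open>v\<close> has its code below \<alpha> and exactly the
    true value is marked, so \<open>SOME\<close> recovers it.\<close>
  define dec where "dec \<alpha> h = (\<lambda>l. if set l \<subseteq> (\<Union>i\<in>underS r \<alpha>. B i)
       then (\<lambda>q. SOME v. h (e (l, q, v)) = Some True) else (\<lambda>_. 0))" for \<alpha> h
  \<comment> \<open>A partial function reveals its ordinal through its domain, since different
    points have different initial segments. This is how \<open>F\<close> may depend on
    \<alpha>.\<close>
  define F' where "F' h = F (THE \<alpha>. \<alpha> \<in> Field r \<and> underS r \<alpha> = dom h) (dec (THE \<alpha>. \<alpha> \<in> Field r \<and> underS r \<alpha> = dom h) h)" for h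
  from wd obtain g where g: "\<And>f. stationary r {a \<in> S. g a = F' ((\<lambda>b. Some (f b)) |` underS r a)}"
    unfolding weak_diamond_def by blast
  have "\<exists>\<alpha>\<in>S. g \<alpha> = F \<alpha> (\<lambda>l. if set l \<subseteq> (\<Union>i\<in>underS r \<alpha>. B i) then Y l else (\<lambda>_. 0))" for Y
  proof -
    obtain \<alpha> where \<alpha>: "\<alpha> \<in> S" "\<alpha> \<in> C" "g \<alpha> = F' ((\<lambda>b. Some (code Y b)) |` underS r \<alpha>)"
      using g[of "code Y"] C unfolding stationary_def by blast
    let ?h = "(\<lambda>b. Some (code Y b)) |` underS r \<alpha>"
    have dom: "dom ?h = underS r \<alpha>"
      by (auto simp: restrict_map_def dom_def)
    have the: "(THE \<beta>. \<beta> \<in> Field r \<and> underS r \<beta> = dom ?h) = \<alpha>"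
      unfolding dom using S[OF \<alpha>(1)] underS_inj[OF wo] by (intro the_equality) auto
    have "dec \<alpha> ?h = (\<lambda>l. if set l \<subseteq> (\<Union>i\<in>underS r \<alpha>. B i) then Y l else (\<lambda>_. 0))"
    proof
      fix l
      show "dec \<alpha> ?h l = (if set l \<subseteq> (\<Union>i\<in>underS r \<alpha>. B i) then Y l else (\<lambda>_. 0))"
      proof (cases "set l \<subseteq> (\<Union>i\<in>underS r \<alpha>. B i)")
        case True
        then obtain \<beta> where \<beta>: "\<beta> \<in> underS r \<alpha>" "set l \<subseteq> (\<Union>i\<in>under r \<beta>. B i)"
          using list_in_UN_underS[OF wo _ True] S[OF \<alpha>(1)] by blast
        have \<beta>F: "\<beta> \<in> Field r"
          using \<beta> Order_Relation.underS_Field[of r \<alpha>] by auto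
        have lF: "set l \<subseteq> (\<Union>i\<in>Field r. B i)"
          using True Order_Relation.underS_Field[of r \<alpha>] by blast
        have "?h (e (l, q, v)) = Some True \<longleftrightarrow> v = Y l q" for q v
        proof -
          have "(l, q, v) \<in> T (under r \<beta>)"
            using \<beta>(2) by (auto simp: T_def in_lists_conv_set)
          then have "e (l, q, v) \<in> underS r (G \<beta>)"
            using eG[OF \<beta>F] by blast
          moreover have "G \<beta> \<in> underS r \<alpha>"
            using \<alpha>(2) \<beta>(1) by (auto simp: C_def)
          ultimately have "e (l, q, v) \<in> underS r \<alpha>"
            by (rule underS_trans[OF wo])
          then have "?h (e (l, q, v)) = Some True \<longleftrightarrow> code Y (e (l, q, v))"
            by simp
          also have "\<dots> \<longleftrightarrow> v = Y l q"
          proof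
            assume "code Y (e (l, q, v))"
            then obtain l' q' where *: "set l' \<subseteq> (\<Union>i\<in>Field r. B i)" "e (l, q, v) = e (l', q', Y l' q')"
              unfolding code_def by blast
            have "(l, q, v) = (l', q', Y l' q')"
              by (rule inj_onD[OF e(1) *(2)]) (use *(1) lF in \<open>auto simp: T_def in_lists_conv_set\<close>)
            then show "v = Y l q" by simp
          qed (use lF in \<open>auto simp: code_def\<close>)
          finally show ?thesis .
        qed
        then show ?thesis
          using True by (simp add: dec_def)
      qed (auto simp: dec_def)
    qed
    then show ?thesis
      using \<alpha>(1,3) unfolding F'_def the by auto
  qed
  then show ?thesis
    by blast
qed

section \<open>Increasing sequences by recursion\<close>

lemma well_order_recursion:
  assumes s: "Well_order s"
    and step: "\<And>\<xi> f. \<xi> \<in> Field s \<Longrightarrow> (\<And>\<eta>. \<eta> \<in> underS s \<xi> \<Longrightarrow> f \<eta> \<in> A)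
       \<Longrightarrow> \<exists>\<gamma>\<in>A. Q \<xi> \<gamma> \<and> (\<forall>\<eta>\<in>underS s \<xi>. lt (f \<eta>) \<gamma>)"
  shows "\<exists>h. \<forall>\<xi>\<in>Field s. h \<xi> \<in> A \<and> Q \<xi> (h \<xi>) \<and> (\<forall>\<eta>\<in>underS s \<xi>. lt (h \<eta>) (h \<xi>))"
proof -
  have wf: "wf (s - Id)"
    using s by (simp add: well_order_on_def)
  define H where "H f \<xi> = (SOME \<gamma>. \<gamma> \<in> A \<and> Q \<xi> \<gamma> \<and> (\<forall>\<eta>\<in>underS s \<xi>. lt (f \<eta>) \<gamma>))" for f \<xi>
  define h where "h = wfrec (s - Id) H"
  have h: "h \<xi> = (SOME \<gamma>. \<gamma> \<in> A \<and> Q \<xi> \<gamma> \<and> (\<forall>\<eta>\<in>underS s \<xi>. lt (h \<eta>) \<gamma>))" for \<xi>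
  proof -
    have "h \<xi> = H (cut h (s - Id) \<xi>) \<xi>"
      unfolding h_def by (rule wfrec[OF wf])
    moreover have "cut h (s - Id) \<xi> \<eta> = h \<eta>" if "\<eta> \<in> underS s \<xi>" for \<eta>
      using that by (auto simp: underS_def cut_apply)
    ultimately show ?thesis
      by (simp add: H_def)
  qed
  have "\<xi> \<in> Field s \<longrightarrow> h \<xi> \<in> A \<and> Q \<xi> (h \<xi>) \<and> (\<forall>\<eta>\<in>underS s \<xi>. lt (h \<eta>) (h \<xi>))" for \<xi>
  proof (induction \<xi> rule: wf_induct_rule[OF wf])
    case (1 \<xi>)
    show ?case
    proof
      assume \<xi>: "\<xi> \<in> Field s"
      have "h \<eta> \<in> A" if "\<eta> \<in> underS s \<xi>" for \<eta>
        using that 1[of \<eta>] Order_Relation.underS_Field[of s \<xi>] by (auto simp: underS_def)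
      then have "\<exists>\<gamma>. \<gamma> \<in> A \<and> Q \<xi> \<gamma> \<and> (\<forall>\<eta>\<in>underS s \<xi>. lt (h \<eta>) \<gamma>)"
        using step[OF \<xi>, of h] by blast
      from someI_ex[OF this] show "h \<xi> \<in> A \<and> Q \<xi> (h \<xi>) \<and> (\<forall>\<eta>\<in>underS s \<xi>. lt (h \<eta>) (h \<xi>))"
        unfolding h[of \<xi>, symmetric] .
    qed
  qed
  then show ?thesis
    by blast
qed

text \<open>The cofinality is given as a well-order \<open>s\<close> of a cofinal set itself, so its
  elements \<xi> are points below \<alpha>, and placing \<open>h \<xi>\<close> at or above \<xi>
  makes \<open>h\<close> cofinal. The earlier values are too few to be cofinal, so some point lies
  strictly above them; the larger of this point and \<xi> serves.\<close>

lemma cof_points_sequence: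
  fixes r :: "'a rel"
  assumes r: "Well_order r" and \<alpha>: "\<alpha> \<in> cof_points k r"
  shows "\<exists>(s :: 'a rel) h. is_aleph k s \<and>
     (\<forall>\<xi>\<in>Field s. h \<xi> \<in> underS r \<alpha> \<and> (\<forall>\<eta>\<in>underS s \<xi>. h \<eta> \<in> underS r (h \<xi>))) \<and>
     (\<forall>\<beta>\<in>underS r \<alpha>. \<exists>\<xi>\<in>Field s. \<beta> \<in> under r (h \<xi>))"
proof -
  let ?U = "underS r \<alpha>" let ?R = "Restr r ?U"
  let ?\<X> = "{X. X \<subseteq> Field ?R \<and> (\<forall>a\<in>Field ?R. \<exists>x\<in>X. (a, x) \<in> ?R)}"
  have U: "?U \<subseteq> Field r"
    by (rule Order_Relation.underS_Field)
  have refl: "(a, a) \<in> r" if "a \<in> Field r" for a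
    using r that by (auto simp: order_on_defs dest: refl_onD)
  have Field: "Field ?R = ?U"
  proof
    show "?U \<subseteq> Field ?R"
    proof
      fix x assume "x \<in> ?U"
      then have "(x, x) \<in> ?R"
        using refl U by blast
      then show "x \<in> Field ?R"
        by (rule FieldI1)
    qed
  qed (auto simp: Field_def)
  have "?U \<in> ?\<X>"
    unfolding Field using refl U by auto
  then have ne: "?\<X> \<noteq> {}"
    by blast
  define s where "s = cofinality ?R"
  obtain X where X: "X \<subseteq> Field ?R" "\<forall>a\<in>Field ?R. \<exists>x\<in>X. (a, x) \<in> ?R" "s = |X|"
    using min_card(1)[OF ne] unfolding s_def cofinality_def by auto
  have least: "s \<le>o |K|" if "K \<subseteq> Field ?R" "\<forall>a\<in>Field ?R. \<exists>x\<in>K. (a, x) \<in> ?R" for K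
    using min_card(2)[OF ne, of K] that unfolding s_def cofinality_def by blast
  have sk: "is_aleph k s"
    using \<alpha> by (simp add: cof_points_def s_def)
  have Fs: "Field s = X"
    unfolding X(3) by (rule Field_card_of)
  have ws: "Well_order s"
    by (rule is_aleph_Well_order[OF sk])
  have "\<exists>h. \<forall>\<xi>\<in>Field s. h \<xi> \<in> ?U \<and> \<xi> \<in> under r (h \<xi>) \<and> (\<forall>\<eta>\<in>underS s \<xi>. h \<eta> \<in> underS r (h \<xi>))"
  proof (rule well_order_recursion[OF ws])
    fix \<xi> f assume \<xi>: "\<xi> \<in> Field s" and f: "\<And>\<eta>. \<eta> \<in> underS s \<xi> \<Longrightarrow> f \<eta> \<in> ?U"
    have "\<xi> \<in> ?U"
      using \<xi> Fs X(1) Field by auto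
    have "|f ` underS s \<xi>| <o s"
      by (rule ordLeq_ordLess_trans[OF card_of_image card_of_underS[OF is_aleph_Card_order[OF sk] \<xi>]])
    then have "\<not> s \<le>o |f ` underS s \<xi>|"
      using not_ordLess_ordLeq by blast
    moreover have "f ` underS s \<xi> \<subseteq> Field ?R"
      using f Field by auto
    ultimately obtain a where a: "a \<in> ?U" "\<And>x. x \<in> f ` underS s \<xi> \<Longrightarrow> (a, x) \<notin> ?R"
      using least[of "f ` underS s \<xi>"] unfolding Field by meson
    have fa: "f \<eta> \<in> underS r a" if "\<eta> \<in> underS s \<xi>" for \<eta>
      using well_order_cases[OF r, of "f \<eta>" a] f[OF that] a(1) a(2)[of "f \<eta>"] that U refl
      by (auto simp: underS_def)
    show "\<exists>\<gamma>\<in>?U. \<xi> \<in> under r \<gamma> \<and> (\<forall>\<eta>\<in>underS s \<xi>. f \<eta> \<in> underS r \<gamma>)"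
    proof (cases "\<xi> \<in> under r a")
      case True
      then show ?thesis using a(1) fa by blast
    next
      case False
      then have "a \<in> underS r \<xi>"
        using well_order_cases[OF r, of \<xi> a] a(1) \<open>\<xi> \<in> ?U\<close> U underS_insert[OF r, of a] by auto
      then show ?thesis
        using \<open>\<xi> \<in> ?U\<close> fa underS_trans[OF r] refl U by (intro bexI[of _ \<xi>]) (auto simp: under_def)
    qed
  qed
  then obtain h where h: "\<forall>\<xi>\<in>Field s. h \<xi> \<in> ?U \<and> \<xi> \<in> under r (h \<xi>) \<and> (\<forall>\<eta>\<in>underS s \<xi>. h \<eta> \<in> underS r (h \<xi>))"
    by blast
  have "\<exists>\<xi>\<in>Field s. \<beta> \<in> under r (h \<xi>)" if \<beta>: "\<beta> \<in> ?U" for \<beta>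
  proof -
    obtain \<xi> where \<xi>: "\<xi> \<in> Field s" "(\<beta>, \<xi>) \<in> r"
      using bspec[OF X(2), of \<beta>] \<beta> unfolding Field Fs by blast
    moreover have "(\<xi>, h \<xi>) \<in> r"
      using h \<xi>(1) by (auto simp: under_def)
    ultimately have "(\<beta>, h \<xi>) \<in> r"
      using r by (auto simp: order_on_defs dest: transD)
    then show ?thesis
      using \<xi>(1) by (auto simp: under_def)
  qed
  then show ?thesis
    using sk h by blast
qed

section \<open>Cocycles that are nontrivial on chains\<close>

definition almost_eq :: "'p set \<Rightarrow> 'p set \<Rightarrow> bool" where
  "almost_eq s t \<longleftrightarrow> finite (s - t) \<and> finite (t - s)"

text \<open>A finite modification is determined by the finite sets removed and added. Hence each
  index contributes only countably many sets to the data guessed by the weak diamond.\<close>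

lemma countable_almost_eq: "countable {s. almost_eq s (t :: 'p::countable set)}"
proof -
  have "countable {F :: 'p set. finite F}"
    using countable_Collect_finite_subset[of "UNIV :: 'p set"] by simp
  then have "countable ((\<lambda>(F, G). (t - F) \<union> G) ` ({F. finite F} \<times> {F. finite F}))"
    by auto
  moreover have "{s. almost_eq s t} \<subseteq> (\<lambda>(F, G). (t - F) \<union> G) ` ({F. finite F} \<times> {F. finite F})"
  proof safe
    fix s assume "almost_eq s t"
    then have "(t - s, s - t) \<in> {F. finite F} \<times> {F. finite F}"
      by (simp add: almost_eq_def)
    moreover have "s = (\<lambda>(F, G). (t - F) \<union> G) (t - s, s - t)"
      by auto
    ultimately show "s \<in> (\<lambda>(F, G). (t - F) \<union> G) ` ({F. finite F} \<times> {F. finite F})"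
      by (rule rev_image_eqI)
  qed
  ultimately show ?thesis
    by (rule countable_subset[rotated])
qed

text \<open>The strictness clause keeps finite modifications of different members apart, so that a
  set in a chain determines its index.\<close>

definition almost_increasing :: "'i rel \<Rightarrow> ('i \<Rightarrow> 'p set) \<Rightarrow> bool" where
  "almost_increasing r a \<longleftrightarrow>
     (\<forall>\<xi>\<in>Field r. \<forall>\<eta>\<in>underS r \<xi>. finite (a \<eta> - a \<xi>) \<and> infinite (a \<xi> - a \<eta>))"

text \<open>The trivialization \<open>z\<close> lives on inclusion chains of finite modifications of the sets \<open>a i\<close>, so that
  it can be obtained by restricting cochains on \<^const>\<open>I0\<close>. For \<open>k = 0\<close> the chain is empty, the
  bound \<open>c\<close> takes the place of its least element, and \<open>z\<close> contributes 0.\<close>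

definition chain_triv ::
    "'i set \<Rightarrow> ('i \<Rightarrow> 'p set) \<Rightarrow> 'p set \<Rightarrow> nat \<Rightarrow> ('p set list \<Rightarrow> 'p \<Rightarrow> 'v::ab_group_add)
      \<Rightarrow> ('i list \<Rightarrow> 'p \<Rightarrow> 'v) \<Rightarrow> bool" where
  "chain_triv I a c k z \<phi> \<longleftrightarrow> (\<forall>is ls. length ls = k \<longrightarrow> sorted_wrt (\<subseteq>) ls \<longrightarrow>
     list_all2 (\<lambda>i s. i \<in> I \<and> s \<subseteq> c \<and> almost_eq s (a i)) is ls \<longrightarrow>
     aeq (hd (ls @ [c])) (\<lambda>p. cobd (\<lambda>m. z m p) ls) (\<phi> is))"

lemma chain_triv_mono: "chain_triv I a c k z \<phi> \<Longrightarrow> J \<subseteq> I \<Longrightarrow> chain_triv J a c k z \<phi>"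
  unfolding chain_triv_def by (blast intro: list_all2_mono)

lemma chain_triv_cong:
  assumes "\<And>is. length is = k \<Longrightarrow> set is \<subseteq> I \<Longrightarrow> \<phi> is = \<psi> is" "chain_triv I a c k z \<phi>"
  shows "chain_triv I a c k z \<psi>"
  unfolding chain_triv_def
proof safe
  fix "is" and ls :: "'b set list"
  assume *: "k = length ls" "sorted_wrt (\<subseteq>) ls"
    and l: "list_all2 (\<lambda>i s. i \<in> I \<and> s \<subseteq> c \<and> almost_eq s (a i)) is ls"
  have "set is \<subseteq> I"
    using l by (auto simp: list_all2_conv_all_nth in_set_conv_nth)
  then have "\<phi> is = \<psi> is"
    using assms(1) l * by (auto dest: list_all2_lengthD)
  moreover have "aeq (hd (ls @ [c])) (\<lambda>p. cobd (\<lambda>m. z m p) ls) (\<phi> is)"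
    using assms(2) * l unfolding chain_triv_def by blast
  ultimately show "aeq (hd (ls @ [c])) (\<lambda>p. cobd (\<lambda>m. z m p) ls) (\<psi> is)"
    by simp
qed

definition nontriv ::
    "'i set \<Rightarrow> ('i \<Rightarrow> 'p set) \<Rightarrow> 'p set \<Rightarrow> nat \<Rightarrow> ('i list \<Rightarrow> 'p \<Rightarrow> 'v::ab_group_add) \<Rightarrow> bool" where
  "nontriv I a c k \<phi> \<longleftrightarrow> cocycle I a k \<phi> \<and> \<not> (\<exists>z. chain_triv I a c k z \<phi>)"

text \<open>In degree 0 a cocycle is one function with finite support on every \<open>a i\<close>,
  trivial when its support on \<open>c\<close> is finite. What is needed is an infinite subset of
  \<open>c\<close> almost disjoint from every \<open>a i\<close>, found by diagonalizing over the
  countably many indices.\<close>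

lemma nontriv_0:
  fixes a :: "'a \<Rightarrow> 'p::countable set"
  assumes r: "is_aleph 0 (r :: 'a rel)" and a: "almost_increasing r a"
    and c: "\<And>\<xi>. \<xi> \<in> Field r \<Longrightarrow> finite (a \<xi> - c)"
  shows "\<exists>\<phi> :: 'a list \<Rightarrow> 'p \<Rightarrow> int. nontriv (Field r) a c 0 \<phi>"
proof -
  have wo: "Well_order r"
    by (rule is_aleph_Well_order[OF r])
  have "|Field r| \<le>o |UNIV :: nat set|"
  proof -
    have "|Field r| =o r"
      by (rule card_of_Field_ordIso[OF is_aleph_Card_order[OF r]])
    also have "r =o natLeq"
      using r by simp
    also have "natLeq =o |UNIV :: nat set|"
      by (rule ordIso_symmetric[OF card_of_nat])
    finally show ?thesis
      by (rule ordIso_imp_ordLeq)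
  qed
  then have cI: "countable (Field r)"
    using card_of_ordLeq[of "Field r" "UNIV :: nat set"] by (auto simp: countable_def)
  define e where "e = from_nat_into (Field r)"
  have ne: "Field r \<noteq> {}"
    using is_aleph_infinite[OF r] by auto
  have e: "range e = Field r"
    unfolding e_def by (rule range_from_nat_into[OF ne cI])
  \<comment> \<open>Take \<zeta> beyond the largest \<xi> of the first indices: infinitely much of
    \<open>a \<zeta>\<close> is outside \<open>a \<xi>\<close>, which almost contains the union, and
    almost all of \<open>a \<zeta>\<close> lies in \<open>c\<close>.\<close>
  have inf: "infinite (c - (\<Union>m\<le>n. a (e m)))" for n
  proof -
    obtain \<xi> where \<xi>: "\<xi> \<in> Field r" "e ` {..n} \<subseteq> under r \<xi>"
    proof -
      have eq: "set (map e [0..<Suc n]) = e ` {..n}"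
        by (simp add: atLeast0LessThan lessThan_Suc_atMost del: upt_Suc)
      have sub: "e ` {..n} \<subseteq> Field r"
        using e by auto
      then have "\<exists>\<xi>\<in>e ` {..n}. e ` {..n} \<subseteq> under r \<xi>"
        using ex_max_list[OF wo, of "map e [0..<Suc n]"] unfolding eq by simp
      then show ?thesis
        using that sub by blast
    qed
    obtain \<zeta> where \<zeta>: "\<zeta> \<in> Field r" "\<xi> \<in> underS r \<zeta>"
      using infinite_Card_order_limit[OF is_aleph_Card_order[OF r] is_aleph_infinite[OF r] \<xi>(1)]
      by (auto simp: underS_def)
    have fin: "finite (a (e m) - a \<xi>)" if "m \<le> n" for m
      using \<xi> that a underS_insert[OF wo \<xi>(1)] by (cases "e m = \<xi>") (auto simp: almost_increasing_def)
    show ?thesis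
    proof
      assume "finite (c - (\<Union>m\<le>n. a (e m)))"
      then have "finite ((a \<zeta> - c) \<union> (c - (\<Union>m\<le>n. a (e m))) \<union> (\<Union>m\<le>n. (a (e m) - a \<xi>)))"
        using c[OF \<zeta>(1)] fin by (simp del: UN_simps)
      then have "finite (a \<zeta> - a \<xi>)"
        by (rule rev_finite_subset) auto
      then show False
        using a \<zeta> unfolding almost_increasing_def by blast
    qed
  qed
  \<comment> \<open>The clause on \<open>to_nat\<close> makes the range of the sequence infinite
    even if values repeat.\<close>
  have "\<exists>p. p \<in> c \<and> p \<notin> (\<Union>m\<le>n. a (e m)) \<and> to_nat p \<ge> n" for n
  proof (rule ccontr)
    assume "\<not> ?thesis"
    then have "to_nat ` (c - (\<Union>m\<le>n. a (e m))) \<subseteq> {..<n}"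
      by force
    then have "finite (to_nat ` (c - (\<Union>m\<le>n. a (e m))))"
      using finite_subset by blast
    then show False
      using inf[of n] finite_imageD[of to_nat] inj_on_subset[OF inj_to_nat] by blast
  qed
  then obtain q where q: "\<And>n. q n \<in> c \<and> q n \<notin> (\<Union>m\<le>n. a (e m)) \<and> to_nat (q n) \<ge> n"
    by metis
  have infq: "infinite (range q)"
  proof
    assume "finite (range q)"
    then have "finite (to_nat ` range q)"
      by blast
    then obtain N where "\<And>n. to_nat (q n) < N"
      using finite_nat_set_iff_bounded[of "to_nat ` range q"] by auto
    then show False
      using q[of N] by (meson not_less)
  qed
  define \<phi> :: "'a list \<Rightarrow> 'p \<Rightarrow> int" where "\<phi> l p = (if p \<in> range q then 1 else 0)" for l p
  have "cocycle (Field r) a 0 \<phi>"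
    unfolding is_cobd_def
  proof safe
    fix l assume l: "length l = Suc 0" "set l \<subseteq> Field r"
    then obtain i where i: "l = [i]" "i \<in> Field r"
      by (cases l) auto
    then obtain n where n: "i = e n"
      using e by auto
    have "{p \<in> a i. p \<in> range q} \<subseteq> q ` {..<n}"
    proof safe
      fix m assume "q m \<in> a i"
      then have "\<not> n \<le> m"
        using q[of m] n by auto
      then show "q m \<in> q ` {..<n}"
        by auto
    qed
    then have "finite {p \<in> a i. p \<in> range q}"
      by (rule finite_subset) simp
    moreover have "{p \<in> a i. \<phi> [] p \<noteq> 0} = {p \<in> a i. p \<in> range q}"
      by (auto simp: \<phi>_def)
    ultimately show "aeq (\<Inter> (a ` set l)) (\<lambda>p. cobd (\<lambda>m. \<phi> m p) l) (\<lambda>_. 0)"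
      using i by (simp add: aeq_def cobd.simps)
  qed
  moreover have "\<not> chain_triv (Field r) a c 0 z \<phi>" for z
  proof
    assume "chain_triv (Field r) a c 0 z \<phi>"
    then have "aeq c (\<lambda>p. 0) (\<phi> [])"
      by (simp add: chain_triv_def)
    moreover have "{p \<in> c. 0 \<noteq> \<phi> [] p} = range q"
      using q by (auto simp: \<phi>_def)
    ultimately show False
      using infq by (simp add: aeq_def)
  qed
  ultimately show ?thesis
    unfolding nontriv_def by blast
qed

text \<open>The cocycle is pulled back along \<tau>, which sends \<beta> to the least \<xi> with
  \<open>h \<xi>\<close> at or above \<beta>. It stays a cocycle as \<open>a \<beta>\<close> is
  almost contained in \<open>a (h (\<tau> \<beta>))\<close>; and since \<tau> is a left inverse of
  \<open>h\<close>, a trivialization of the pullback also trivializes \<psi>.\<close>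

lemma nontriv_cofinal:
  fixes s :: "'j rel" and r :: "'i rel" and a :: "'i \<Rightarrow> 'p set"
    and \<psi> :: "'j list \<Rightarrow> 'p \<Rightarrow> 'v::ab_group_add"
  assumes r: "Well_order r" and s: "Well_order s"
    and h: "\<And>\<xi>. \<xi> \<in> Field s \<Longrightarrow> h \<xi> \<in> I"
      "\<And>\<xi> \<eta>. \<xi> \<in> Field s \<Longrightarrow> \<eta> \<in> underS s \<xi> \<Longrightarrow> h \<eta> \<in> underS r (h \<xi>)"
    and cof: "\<And>\<beta>. \<beta> \<in> I \<Longrightarrow> \<exists>\<xi>\<in>Field s. \<beta> \<in> under r (h \<xi>)"
    and I: "I \<subseteq> Field r" and a: "almost_increasing r a"
    and \<psi>: "nontriv (Field s) (a \<circ> h) c k \<psi>"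
  shows "\<exists>\<phi> :: 'i list \<Rightarrow> 'p \<Rightarrow> 'v. nontriv I a c k \<phi>"
proof -
  have "\<exists>\<xi>. \<xi> \<in> Field s \<and> \<beta> \<in> under r (h \<xi>) \<and> (\<forall>\<eta>\<in>underS s \<xi>. \<beta> \<notin> under r (h \<eta>))"
    if "\<beta> \<in> I" for \<beta>
  proof -
    have "{\<xi> \<in> Field s. \<beta> \<in> under r (h \<xi>)} \<noteq> {}"
      using cof[OF that] by auto
    then obtain \<xi> where "\<xi> \<in> Field s" "\<beta> \<in> under r (h \<xi>)"
      "\<And>\<eta>. \<eta> \<in> underS s \<xi> \<Longrightarrow> \<eta> \<notin> {\<xi> \<in> Field s. \<beta> \<in> under r (h \<xi>)}"
      using well_order_least[OF s, of "{\<xi> \<in> Field s. \<beta> \<in> under r (h \<xi>)}"] by auto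
    then show ?thesis
      using Order_Relation.underS_Field[of s \<xi>] by blast
  qed
  then obtain \<tau> where \<tau>: "\<And>\<beta>. \<beta> \<in> I \<Longrightarrow> \<tau> \<beta> \<in> Field s"
      "\<And>\<beta>. \<beta> \<in> I \<Longrightarrow> \<beta> \<in> under r (h (\<tau> \<beta>))"
      "\<And>\<beta> \<eta>. \<beta> \<in> I \<Longrightarrow> \<eta> \<in> underS s (\<tau> \<beta>) \<Longrightarrow> \<beta> \<notin> under r (h \<eta>)"
    by metis
  have \<tau>h: "\<tau> (h \<xi>) = \<xi>" if \<xi>: "\<xi> \<in> Field s" for \<xi>
  proof (rule ccontr)
    assume "\<tau> (h \<xi>) \<noteq> \<xi>"
    have hI: "h \<xi> \<in> I" "h \<xi> \<in> Field r"
      using h(1)[OF \<xi>] I by auto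
    then have "\<tau> (h \<xi>) \<in> underS s \<xi> \<or> \<xi> \<in> underS s (\<tau> (h \<xi>))"
      using well_order_cases[OF s \<tau>(1)[OF hI(1)] \<xi>] \<open>\<tau> (h \<xi>) \<noteq> \<xi>\<close> by auto
    then show False
    proof
      assume "\<tau> (h \<xi>) \<in> underS s \<xi>"
      then have "h \<xi> \<in> underS r (h \<xi>)"
        using under_underS_trans[OF r \<tau>(2)[OF hI(1)]] h(2)[OF \<xi>] by blast
      then show False
        by (simp add: underS_def)
    next
      assume "\<xi> \<in> underS s (\<tau> (h \<xi>))"
      then have "h \<xi> \<notin> under r (h \<xi>)"
        by (rule \<tau>(3)[OF hI(1)])
      then show False
        using underS_insert[OF r hI(2)] by simp
    qed
  qed
  define \<phi> where "\<phi> l = \<psi> (map \<tau> l)" for l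
  have "cocycle I a k \<phi>"
    unfolding is_cobd_def
  proof safe
    fix l assume l: "length l = Suc k" "set l \<subseteq> I"
    have "aeq (\<Inter> ((a \<circ> h) ` set (map \<tau> l))) (\<lambda>p. cobd (\<lambda>m. \<psi> m p) (map \<tau> l)) (\<lambda>_. 0)"
      using conjunct1[OF \<psi>[unfolded nontriv_def], unfolded is_cobd_def, rule_format, of "map \<tau> l"] l \<tau>(1)
      by auto
    moreover have "finite (\<Inter> (a ` set l) - \<Inter> ((a \<circ> h) ` set (map \<tau> l)))"
    proof (rule finite_subset)
      show "\<Inter> (a ` set l) - \<Inter> ((a \<circ> h) ` set (map \<tau> l)) \<subseteq> (\<Union>i\<in>set l. a i - a (h (\<tau> i)))"
        by auto
      have "finite (a i - a (h (\<tau> i)))" if "i \<in> I" for i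
      proof (cases "i = h (\<tau> i)")
        case False
        have "h (\<tau> i) \<in> Field r"
          using h(1)[OF \<tau>(1)[OF that]] I by auto
        then show ?thesis
          using \<tau>(2)[OF that] a False underS_insert[OF r] unfolding almost_increasing_def by blast
      qed simp
      then show "finite (\<Union>i\<in>set l. a i - a (h (\<tau> i)))"
        using l(2) by auto
    qed
    ultimately have "aeq (\<Inter> (a ` set l)) (\<lambda>p. cobd (\<lambda>m. \<psi> m p) (map \<tau> l)) (\<lambda>_. 0)"
      by (rule aeq_mono)
    then show "aeq (\<Inter> (a ` set l)) (\<lambda>p. cobd (\<lambda>m. \<phi> m p) l) (\<lambda>_. 0)"
      by (simp add: cobd_map \<phi>_def)
  qed
  moreover have "\<not> chain_triv I a c k z \<phi>" for z
  proof
    assume z: "chain_triv I a c k z \<phi>"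
    have "chain_triv (Field s) (a \<circ> h) c k z \<psi>"
      unfolding chain_triv_def
    proof safe
      fix "is" and ls :: "'p set list"
      assume *: "k = length ls" "sorted_wrt (\<subseteq>) ls"
        and l: "list_all2 (\<lambda>i t. i \<in> Field s \<and> t \<subseteq> c \<and> almost_eq t ((a \<circ> h) i)) is ls"
      have "list_all2 (\<lambda>i t. i \<in> I \<and> t \<subseteq> c \<and> almost_eq t (a i)) (map h is) ls"
        unfolding list.rel_map by (rule list_all2_mono[OF l]) (auto simp: h(1))
      then have "aeq (hd (ls @ [c])) (\<lambda>p. cobd (\<lambda>m. z m p) ls) (\<phi> (map h is))"
        using z * unfolding chain_triv_def by blast
      moreover have "map \<tau> (map h is) = is"
      proof -
        have "set is \<subseteq> Field s"
          using l by (auto simp: list_all2_conv_all_nth in_set_conv_nth)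
        then show ?thesis
          by (auto intro!: map_idI simp: \<tau>h)
      qed
      ultimately show "aeq (hd (ls @ [c])) (\<lambda>p. cobd (\<lambda>m. z m p) ls) (\<psi> is)"
        unfolding \<phi>_def by simp
    qed
    then show False
      using \<psi> unfolding nontriv_def by blast
  qed
  ultimately show ?thesis
    unfolding nontriv_def by blast
qed

text \<open>The cocycle on \<^term>\<open>underS r \<alpha>\<close> is \<open>\<delta>\<Theta>\<close> modulo finite errors, and \<open>\<delta>\<Theta>\<close> and \<open>\<delta>(\<Theta> + \<Psi>)\<close> are two
  extensions of it to \<open>\<alpha>\<close>, where \<open>\<Psi>\<close> is a nontrivial cocycle of one degree less. If a
  trivialization below \<open>\<alpha>\<close> extended to trivializations of both, the difference of these, evaluated at
  chains with last entry \<open>a \<alpha> \<inter> c\<close>, would trivialize \<open>\<Psi>\<close>.\<close>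

lemma nontriv_Suc:
  fixes r :: "'a rel" and a :: "'a \<Rightarrow> 'p::countable set"
  assumes r: "is_aleph (Suc k) r" and a: "almost_increasing r a"
    and c: "\<And>\<xi>. \<xi> \<in> Field r \<Longrightarrow> finite (a \<xi> - c)"
    and wd: "weak_diamond r (cof_points k r)"
    and prev: "\<And>\<alpha>. \<alpha> \<in> cof_points k r \<Longrightarrow>
       \<exists>\<psi> :: 'a list \<Rightarrow> 'p \<Rightarrow> int. nontriv (underS r \<alpha>) a (a \<alpha> \<inter> c) k \<psi>"
  shows "\<exists>\<phi> :: 'a list \<Rightarrow> 'p \<Rightarrow> int. nontriv (Field r) a c (Suc k) \<phi>"
proof -
  have wo: "Well_order r"
    by (rule is_aleph_Well_order[OF r])
  obtain s :: "'a rel" where s: "is_aleph k s"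
    using r by auto
  have cof: "\<alpha> \<in> Field r \<and> underS r \<alpha> \<noteq> {}" if \<alpha>: "\<alpha> \<in> cof_points k r" for \<alpha>
  proof -
    obtain t :: "'a rel" and h where t: "is_aleph k t" "\<forall>\<xi>\<in>Field t. h \<xi> \<in> underS r \<alpha>"
      using cof_points_sequence[OF wo \<alpha>] by blast
    have "Field t \<noteq> {}"
      using is_aleph_infinite[OF t(1)] by auto
    then show ?thesis
      using t(2) \<alpha> by (auto simp: cof_points_def)
  qed
  define \<Theta> where "\<Theta> \<alpha> \<chi> = (SOME \<theta>. is_cobd (underS r \<alpha>) a k \<theta> \<chi>)"
    for \<alpha> and \<chi> :: "'a list \<Rightarrow> 'p \<Rightarrow> int"
  have \<Theta>: "is_cobd (underS r \<alpha>) a k (\<Theta> \<alpha> \<chi>) \<chi>"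
    if "\<alpha> \<in> Field r" "cocycle (underS r \<alpha>) a (Suc k) \<chi>" for \<alpha> \<chi>
    unfolding \<Theta>_def
    by (rule someI_ex[OF cocycle_is_cobd[OF s underS_ordLeq(1)[OF r s that(1)] order_refl that(2)]])
  have "\<exists>\<psi> :: 'a list \<Rightarrow> 'p \<Rightarrow> int. cocycle (underS r \<alpha>) a k \<psi> \<and>
      (\<alpha> \<in> cof_points k r \<longrightarrow> nontriv (underS r \<alpha>) a (a \<alpha> \<inter> c) k \<psi>)" for \<alpha>
  proof (cases "\<alpha> \<in> cof_points k r")
    case True
    then show ?thesis
      using prev unfolding nontriv_def by blast
  next
    case False
    then show ?thesis
      by (intro exI[of _ "\<lambda>_ _. 0"]) (simp add: is_cobd_def)
  qed
  then obtain \<Psi> :: "'a \<Rightarrow> 'a list \<Rightarrow> 'p \<Rightarrow> int" where \<Psi>: "\<And>\<alpha>. cocycle (underS r \<alpha>) a k (\<Psi> \<alpha>)"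
    and \<Psi>_nontriv: "\<And>\<alpha>. \<alpha> \<in> cof_points k r \<Longrightarrow> nontriv (underS r \<alpha>) a (a \<alpha> \<inter> c) k (\<Psi> \<alpha>)"
    by metis
  \<comment> \<open>Lists through \<alpha> get value 0, so that by \<open>cobd_snoc\<close> the two
    extensions differ at \<open>is @ [\<alpha>]\<close> by exactly
    \<open>\<Psi> \<alpha> is\<close>, up to sign.\<close>
  define cut :: "'a set \<Rightarrow> ('a list \<Rightarrow> 'p \<Rightarrow> int) \<Rightarrow> 'a list \<Rightarrow> 'p \<Rightarrow> int"
    where "cut K \<theta> l = (if set l \<subseteq> K then \<theta> l else (\<lambda>_. 0))" for K \<theta> l
  define D where "D b \<alpha> \<chi> = (\<lambda>l p. cut (underS r \<alpha>) (\<Theta> \<alpha> \<chi>) l p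
      + (if b then cut (underS r \<alpha>) (\<Psi> \<alpha>) l p else 0))" for b \<alpha> \<chi>
  define E where "E b \<alpha> \<chi> l = (if set l \<subseteq> underS r \<alpha> then \<chi> l else (\<lambda>p. cobd (\<lambda>m. D b \<alpha> \<chi> m p) l))"
    for b \<alpha> \<chi> l
  have D: "is_cobd (underS r \<alpha>) a k (D b \<alpha> \<chi>) \<chi>"
    if "\<alpha> \<in> Field r" "cocycle (underS r \<alpha>) a (Suc k) \<chi>" for b \<alpha> \<chi>
  proof -
    have "is_cobd (underS r \<alpha>) a k (\<lambda>l p. \<Theta> \<alpha> \<chi> l p + (if b then \<Psi> \<alpha> l p else 0)) (\<lambda>l p. \<chi> l p + 0)"
      using is_cobd_add[OF \<Theta>[OF that] \<Psi>[of \<alpha>]] \<Theta>[OF that] by (cases b) simp_all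
    moreover have "is_cobd (underS r \<alpha>) a k (D b \<alpha> \<chi>) \<chi> \<longleftrightarrow> is_cobd (underS r \<alpha>) a k
        (\<lambda>l p. \<Theta> \<alpha> \<chi> l p + (if b then \<Psi> \<alpha> l p else 0)) (\<lambda>l p. \<chi> l p + 0)"
      by (rule is_cobd_cong) (simp_all add: D_def cut_def fun_eq_iff)
    ultimately show ?thesis
      by simp
  qed
  have E: "cocycle (under r \<alpha>) a (Suc k) (E b \<alpha> \<chi>)"
    if "\<alpha> \<in> Field r" "cocycle (underS r \<alpha>) a (Suc k) \<chi>" for b \<alpha> \<chi>
  proof (rule cocycle_aeq[OF cocycle_cobd[of _ _ _ "D b \<alpha> \<chi>"]])
    fix l assume "length l = Suc k" "set l \<subseteq> under r \<alpha>"
    then show "aeq (\<Inter> (a ` set l)) (E b \<alpha> \<chi> l) (\<lambda>p. cobd (\<lambda>m. D b \<alpha> \<chi> m p) l)"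
      using D[OF that, of b] unfolding is_cobd_def by (simp add: E_def aeq_sym)
  qed
  define J where "J \<alpha> = {t. t \<subseteq> c \<and> (\<exists>i\<in>underS r \<alpha>. almost_eq t (a i))}" for \<alpha>
  \<comment> \<open>The disjoint sum lets one function \<open>Y\<close> carry both a potential
    trivialization, on sets, and the cocycle built so far, on indices.\<close>
  define B where "B i = Inl ` {t. t \<subseteq> c \<and> almost_eq t (a i)} \<union> {Inr i}" for i
  have inl: "set (map Inl ls) \<subseteq> (\<Union>i\<in>underS r \<alpha>. B i)" if ls: "set ls \<subseteq> J \<alpha>" for ls :: "'p set list" and \<alpha>
  proof
    fix x :: "'p set + 'a" assume "x \<in> set (map Inl ls)"
    then obtain t where "x = Inl t" "t \<in> J \<alpha>"
      using ls by auto
    then show "x \<in> (\<Union>i\<in>underS r \<alpha>. B i)"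
      unfolding J_def B_def by blast
  qed
  have inr: "set (map Inr is) \<subseteq> (\<Union>i\<in>underS r \<alpha>. B i)" if "set is \<subseteq> underS r \<alpha>" for "is" \<alpha>
    using that unfolding B_def by auto
  have B: "|B i| \<le>o s" if "i \<in> Field r" for i
  proof (rule countable_ordLeq_Cinfinite[OF _ is_aleph_Cinfinite[OF s]])
    have "countable {t. t \<subseteq> c \<and> almost_eq t (a i)}"
      by (rule countable_subset[OF _ countable_almost_eq[of "a i"]]) auto
    then show "countable (B i)"
      unfolding B_def by simp
  qed
  \<comment> \<open>\<open>F\<close> asks whether the trivialization coded by \<open>Y\<close>
    survives the extension \<open>False\<close>. Its answer is the harmful choice:
    \<open>True\<close> if \<open>False\<close> is survived, and \<open>False\<close> if not. A
    correct guess can therefore serve directly as the selector.\<close>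
  define F where "F \<alpha> Y \<longleftrightarrow> (\<exists>y. (\<forall>ls. set ls \<subseteq> J \<alpha> \<longrightarrow> y ls = Y (map Inl ls)) \<and>
      chain_triv (under r \<alpha>) a c (Suc k) y (E False \<alpha> (res (underS r \<alpha>) (\<lambda>is. Y (map Inr is)))))"
    for \<alpha> and Y :: "('p set + 'a) list \<Rightarrow> 'p \<Rightarrow> int"
  obtain g :: "'a \<Rightarrow> bool" where g: "\<forall>Y. \<exists>\<alpha>\<in>cof_points k r.
      g \<alpha> = F \<alpha> (\<lambda>l. if set l \<subseteq> (\<Union>i\<in>underS r \<alpha>. B i) then Y l else (\<lambda>_. 0))"
    by (rule exE[OF weak_diamond_lists[OF r s wd cof B, where F = F]])
  \<comment> \<open>There is no circularity: \<open>g\<close> is fixed before \<phi> and handles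
    every \<open>Y\<close>, including the one that will contain \<phi>.\<close>
  have "\<exists>\<phi>. (\<forall>\<alpha>\<in>Field r. \<forall>l. l \<noteq> [] \<longrightarrow> set l \<subseteq> under r \<alpha> \<longrightarrow> \<phi> l = E (g \<alpha>) \<alpha> (res (underS r \<alpha>) \<phi>) l)
     \<and> (\<forall>l. l \<noteq> [] \<longrightarrow> set l \<subseteq> Field r \<longrightarrow> cocycle (set l) a (Suc k) \<phi>)"
  proof (rule extension_recursion[OF wo])
    fix \<chi> \<chi>' :: "'a list \<Rightarrow> 'p \<Rightarrow> int" and l :: "'a list"
    assume *: "\<And>m. m \<noteq> [] \<Longrightarrow> set m \<subseteq> set l \<Longrightarrow> \<chi> m = \<chi>' m" and "cocycle (set l) a (Suc k) \<chi>"
    then show "cocycle (set l) a (Suc k) \<chi>'"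
      using is_cobd_cong_nonempty[of "set l" \<chi> \<chi>' a k] by blast
  next
    fix \<alpha> and \<chi> :: "'a list \<Rightarrow> 'p \<Rightarrow> int" and l assume "\<alpha> \<in> Field r" "l \<noteq> []" "set l \<subseteq> underS r \<alpha>"
    then show "E (g \<alpha>) \<alpha> \<chi> l = \<chi> l"
      by (simp add: E_def)
  next
    fix \<alpha> and \<chi> :: "'a list \<Rightarrow> 'p \<Rightarrow> int" and l assume *: "\<alpha> \<in> Field r" "l \<noteq> []" "set l \<subseteq> under r \<alpha>"
      and "\<And>l. l \<noteq> [] \<Longrightarrow> set l \<subseteq> underS r \<alpha> \<Longrightarrow> cocycle (set l) a (Suc k) \<chi>"
    then have "cocycle (underS r \<alpha>) a (Suc k) \<chi>"
      by (subst is_cobd_local) simp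
    then show "cocycle (set l) a (Suc k) (E (g \<alpha>) \<alpha> \<chi>)"
      by (rule is_cobd_mono[OF E[OF *(1)] *(3)])
  qed
  then obtain \<phi> :: "'a list \<Rightarrow> 'p \<Rightarrow> int" where
    \<phi>: "\<forall>\<alpha>\<in>Field r. \<forall>l. l \<noteq> [] \<longrightarrow> set l \<subseteq> under r \<alpha> \<longrightarrow> \<phi> l = E (g \<alpha>) \<alpha> (res (underS r \<alpha>) \<phi>) l"
    and *: "\<forall>l. l \<noteq> [] \<longrightarrow> set l \<subseteq> Field r \<longrightarrow> cocycle (set l) a (Suc k) \<phi>"
    by (elim exE conjE)
  from * have \<phi>_cocycle: "cocycle (Field r) a (Suc k) \<phi>"
    by (subst is_cobd_local) simp
  have "\<not> chain_triv (Field r) a c (Suc k) z \<phi>" for z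
  proof
    assume z: "chain_triv (Field r) a c (Suc k) z \<phi>"
    \<comment> \<open>The empty list is of both kinds. It is given to \<open>z\<close>, since
      \<open>res\<close> blanks the value of \<phi> there.\<close>
    define Y :: "('p set + 'a) list \<Rightarrow> 'p \<Rightarrow> int"
      where "Y l = (if l = [] \<or> isl (hd l) then z (map projl l) else \<phi> (map projr l))" for l
    have Y_inl: "Y (map Inl ls) = z ls" for ls
      by (cases ls) (simp_all add: Y_def o_def)
    have Y_inr: "Y (map Inr is) = \<phi> is" if "is \<noteq> []" for "is"
      using that by (cases "is") (simp_all add: Y_def o_def)
    obtain \<alpha> where \<alpha>: "\<alpha> \<in> cof_points k r"
      and g\<alpha>: "g \<alpha> = F \<alpha> (\<lambda>l. if set l \<subseteq> (\<Union>i\<in>underS r \<alpha>. B i) then Y l else (\<lambda>_. 0))"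
      by (rule bexE[OF g[rule_format, of Y]])
    have \<alpha>F: "\<alpha> \<in> Field r"
      using cof[OF \<alpha>] by simp
    define \<chi> where "\<chi> = res (underS r \<alpha>) \<phi>"
    have res_eq: "res (underS r \<alpha>) (\<lambda>is. (\<lambda>l. if set l \<subseteq> (\<Union>i\<in>underS r \<alpha>. B i) then Y l else (\<lambda>_. 0))
        (map Inr is)) = \<chi>"
      unfolding \<chi>_def res_def using inr[of _ \<alpha>] by (auto simp: fun_eq_iff Y_inr simp del: set_map)
    have F_eq: "F \<alpha> (\<lambda>l. if set l \<subseteq> (\<Union>i\<in>underS r \<alpha>. B i) then Y l else (\<lambda>_. 0)) \<longleftrightarrow>
       (\<exists>y. (\<forall>ls. set ls \<subseteq> J \<alpha> \<longrightarrow> y ls = z ls) \<and> chain_triv (under r \<alpha>) a c (Suc k) y (E False \<alpha> \<chi>))"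
      unfolding F_def res_eq using inl[of _ \<alpha>] by (auto simp: Y_inl simp del: set_map)
    have z\<alpha>: "chain_triv (under r \<alpha>) a c (Suc k) z (E (g \<alpha>) \<alpha> \<chi>)"
    proof (rule chain_triv_cong)
      show "chain_triv (under r \<alpha>) a c (Suc k) z \<phi>"
        by (rule chain_triv_mono[OF z under_Field])
      fix "is" assume "length is = Suc k" "set is \<subseteq> under r \<alpha>"
      then show "\<phi> is = E (g \<alpha>) \<alpha> \<chi> is"
        unfolding \<chi>_def by (intro \<phi>[rule_format, OF \<alpha>F]) auto
    qed
    show False
    proof (cases "g \<alpha>")
      case False
      then show False
        using z\<alpha> g\<alpha> F_eq by auto
    next
      case True
      then obtain y where y: "\<And>ls. set ls \<subseteq> J \<alpha> \<Longrightarrow> y ls = z ls"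
        "chain_triv (under r \<alpha>) a c (Suc k) y (E False \<alpha> \<chi>)"
        using g\<alpha> F_eq by auto
      define d where "d = a \<alpha> \<inter> c"
      \<comment> \<open>\<open>z\<close> and \<open>y\<close> agree on chains from
        \<open>J \<alpha>\<close>, so only lists ending in \<open>d\<close> contribute to the
        difference of their coboundaries. The sign compensates the one that \<open>cobd_snoc\<close>
        gives to \<open>\<Psi> \<alpha>\<close>.\<close>
      define u where "u l p = (if even k then z (l @ [d]) p - y (l @ [d]) p else y (l @ [d]) p - z (l @ [d]) p)"
        for l p
      have "chain_triv (underS r \<alpha>) a d k u (\<Psi> \<alpha>)"
        unfolding chain_triv_def
      proof (intro allI impI)
        fix "is" and ls :: "'p set list"
        assume len: "length ls = k" and sorted: "sorted_wrt (\<subseteq>) ls"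
          and l: "list_all2 (\<lambda>i t. i \<in> underS r \<alpha> \<and> t \<subseteq> d \<and> almost_eq t (a i)) is ls"
        have lsJ: "set ls \<subseteq> J \<alpha>"
          using l unfolding J_def d_def by (fastforce simp: list_all2_conv_all_nth in_set_conv_nth)
        have lsd: "\<forall>t\<in>set ls. t \<subseteq> d"
          using l by (fastforce simp: list_all2_conv_all_nth in_set_conv_nth)
        have is\<alpha>: "set is \<subseteq> underS r \<alpha>"
          using l by (auto simp: list_all2_conv_all_nth in_set_conv_nth)
        have len': "length is = k"
          using l len by (auto dest: list_all2_lengthD)
        have "almost_eq d (a \<alpha>)"
        proof -
          have "a \<alpha> - d = a \<alpha> - c"
            by (auto simp: d_def)
          moreover have "d - a \<alpha> = {}"
            by (auto simp: d_def)
          ultimately show ?thesis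
            using c[OF \<alpha>F] by (simp only: almost_eq_def finite.emptyI)
        qed
        then have l': "list_all2 (\<lambda>i t. i \<in> under r \<alpha> \<and> t \<subseteq> c \<and> almost_eq t (a i)) (is @ [\<alpha>]) (ls @ [d])"
          using underS_insert[OF wo \<alpha>F]
          by (intro list_all2_appendI list_all2_mono[OF l]) (auto simp: d_def)
        have sorted': "sorted_wrt (\<subseteq>) (ls @ [d])"
          using sorted lsd by (simp add: sorted_wrt_append)
        \<comment> \<open>For \<open>k = 0\<close> the chain \<open>ls\<close> is empty and this set
          is \<open>d\<close>, the bound in the lower degree.\<close>
        have hd: "hd ((ls @ [d]) @ [c]) = hd (ls @ [d])"
          by (cases ls) auto
        have "aeq (hd (ls @ [d])) (\<lambda>p. cobd (\<lambda>m. y m p) (ls @ [d])) (E False \<alpha> \<chi> (is @ [\<alpha>]))"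
          using y(2)[unfolded chain_triv_def, rule_format, OF _ sorted' l'] len unfolding hd by simp
        moreover have "aeq (hd (ls @ [d])) (\<lambda>p. cobd (\<lambda>m. z m p) (ls @ [d])) (E True \<alpha> \<chi> (is @ [\<alpha>]))"
          using z\<alpha>[unfolded chain_triv_def, rule_format, OF _ sorted' l'] True len unfolding hd by simp
        ultimately have diff: "aeq (hd (ls @ [d]))
            (\<lambda>p. cobd (\<lambda>m. z m p) (ls @ [d]) - cobd (\<lambda>m. y m p) (ls @ [d]))
            (\<lambda>p. E True \<alpha> \<chi> (is @ [\<alpha>]) p - E False \<alpha> \<chi> (is @ [\<alpha>]) p)"
          by (intro aeq_diff)
        have "E True \<alpha> \<chi> (is @ [\<alpha>]) p - E False \<alpha> \<chi> (is @ [\<alpha>]) p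
            = (if even k then \<Psi> \<alpha> is p else - \<Psi> \<alpha> is p)" for p
        proof -
          have "\<alpha> \<notin> underS r \<alpha>"
            by (simp add: underS_def)
          then have "E True \<alpha> \<chi> (is @ [\<alpha>]) p - E False \<alpha> \<chi> (is @ [\<alpha>]) p
              = cobd (\<lambda>m. cut (underS r \<alpha>) (\<Psi> \<alpha>) m p) (is @ [\<alpha>])"
            by (simp add: E_def D_def cobd_add)
          also have "\<dots> = (if even k then \<Psi> \<alpha> is p else - \<Psi> \<alpha> is p)"
            unfolding cobd_snoc using \<open>\<alpha> \<notin> underS r \<alpha>\<close> is\<alpha> len' by (simp add: cut_def)
          finally show ?thesis .
        qed
        moreover have "cobd (\<lambda>m. z m p) (ls @ [d]) - cobd (\<lambda>m. y m p) (ls @ [d])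
            = (if even k then cobd (\<lambda>m. u m p) ls else - cobd (\<lambda>m. u m p) ls)" for p
          unfolding cobd_snoc using y(1)[OF lsJ] by (simp add: u_def cobd_diff)
        ultimately have "aeq (hd (ls @ [d]))
            (\<lambda>p. if even k then cobd (\<lambda>m. u m p) ls else - cobd (\<lambda>m. u m p) ls)
            (\<lambda>p. if even k then \<Psi> \<alpha> is p else - \<Psi> \<alpha> is p)"
          using diff by simp
        then show "aeq (hd (ls @ [d])) (\<lambda>p. cobd (\<lambda>m. u m p) ls) (\<Psi> \<alpha> is)"
          by (cases "even k") (simp_all add: aeq_def)
      qed
      then show False
        using \<Psi>_nontriv[OF \<alpha>] unfolding nontriv_def d_def by blast
    qed
  qed
  then show ?thesis
    using \<phi>_cocycle unfolding nontriv_def by blast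
qed

text \<open>Sequence, well-order and bound all change in the induction: at \<alpha> the hypothesis
  is applied to a cofinal sequence below \<alpha>, bounded by \<open>a \<alpha> \<inter> c\<close>,
  and the result is spread to the whole segment. The well-order supplied by the cofinality is not
  under control, so the weak diamond is assumed for every one of the right type.\<close>

lemma ex_nontriv:
  fixes r :: "'a rel" and a :: "'a \<Rightarrow> 'p::countable set"
  assumes "is_aleph k r" and "almost_increasing r a"
    and "\<And>\<xi>. \<xi> \<in> Field r \<Longrightarrow> finite (a \<xi> - c)"
    and "\<And>j (r :: 'a rel). j < k \<Longrightarrow> is_aleph (Suc j) r \<Longrightarrow> weak_diamond r (cof_points j r)"
  shows "\<exists>\<phi> :: 'a list \<Rightarrow> 'p \<Rightarrow> int. nontriv (Field r) a c k \<phi>"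
  using assms
proof (induction k arbitrary: r a c)
  case 0
  then show ?case
    by (intro nontriv_0)
next
  case (Suc k)
  have wo: "Well_order r"
    by (rule is_aleph_Well_order[OF Suc.prems(1)])
  show ?case
  proof (rule nontriv_Suc[OF Suc.prems(1,2,3)])
    show "weak_diamond r (cof_points k r)"
      using Suc.prems(1,4) by blast
    fix \<alpha> assume \<alpha>: "\<alpha> \<in> cof_points k r"
    then have \<alpha>F: "\<alpha> \<in> Field r"
      by (simp add: cof_points_def)
    obtain s :: "'a rel" and h where s: "is_aleph k s"
      and h: "\<And>\<xi>. \<xi> \<in> Field s \<Longrightarrow> h \<xi> \<in> underS r \<alpha>"
        "\<And>\<xi> \<eta>. \<xi> \<in> Field s \<Longrightarrow> \<eta> \<in> underS s \<xi> \<Longrightarrow> h \<eta> \<in> underS r (h \<xi>)"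
      and cof: "\<And>\<beta>. \<beta> \<in> underS r \<alpha> \<Longrightarrow> \<exists>\<xi>\<in>Field s. \<beta> \<in> under r (h \<xi>)"
      using cof_points_sequence[OF wo \<alpha>] by blast
    have hF: "h \<xi> \<in> Field r" if "\<xi> \<in> Field s" for \<xi>
      using h(1)[OF that] Order_Relation.underS_Field[of r \<alpha>] by auto
    have "\<exists>\<psi> :: 'a list \<Rightarrow> 'p \<Rightarrow> int. nontriv (Field s) (a \<circ> h) (a \<alpha> \<inter> c) k \<psi>"
    proof (rule Suc.IH[OF s])
      show "almost_increasing s (a \<circ> h)"
        using Suc.prems(2) h(2) hF unfolding almost_increasing_def by simp
      fix \<xi> assume \<xi>: "\<xi> \<in> Field s"
      have "finite (a (h \<xi>) - a \<alpha>)"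
        using Suc.prems(2) \<alpha>F h(1)[OF \<xi>] unfolding almost_increasing_def by blast
      then have "finite ((a (h \<xi>) - a \<alpha>) \<union> (a (h \<xi>) - c))"
        using Suc.prems(3)[OF hF[OF \<xi>]] by simp
      moreover have "(a \<circ> h) \<xi> - a \<alpha> \<inter> c = (a (h \<xi>) - a \<alpha>) \<union> (a (h \<xi>) - c)"
        by auto
      ultimately show "finite ((a \<circ> h) \<xi> - a \<alpha> \<inter> c)"
        by simp
    qed (use Suc.prems(4) in auto)
    then obtain \<psi> :: "'a list \<Rightarrow> 'p \<Rightarrow> int" where \<psi>: "nontriv (Field s) (a \<circ> h) (a \<alpha> \<inter> c) k \<psi>"
      by blast
    show "\<exists>\<psi> :: 'a list \<Rightarrow> 'p \<Rightarrow> int. nontriv (underS r \<alpha>) a (a \<alpha> \<inter> c) k \<psi>"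
      by (rule nontriv_cofinal[OF wo is_aleph_Well_order[OF s] h cof Order_Relation.underS_Field
          Suc.prems(2) \<psi>])
  qed
qed

section \<open>The system A\<close>

lemma carrier_A_group:
  "x \<in> carrier (A_group s) \<longleftrightarrow> x \<in> extensional s \<and> finite {p \<in> s. x p \<noteq> 0}"
  by (auto simp: A_group_def carrier_sum_group PiE_def)

lemma one_A_group: "\<one>\<^bsub>A_group s\<^esub> = (\<lambda>p\<in>s. 0)"
  by (simp add: A_group_def)

lemma mult_A_group: "x \<otimes>\<^bsub>A_group s\<^esub> y = (\<lambda>p\<in>s. x p + y p)"
  by (simp add: A_group_def)

lemma comm_group_A_group: "comm_group (A_group s)"
proof (rule group.group_comm_groupI)
  show "group (A_group s)"
    by (simp add: A_group_def)
qed (simp add: mult_A_group add.commute)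

lemma pow_sign_A_group:
  assumes "x \<in> carrier (A_group s)" "p \<in> s"
  shows "(x [^]\<^bsub>A_group s\<^esub> ((- 1) ^ i :: int)) p = (- 1) ^ i * x p"
proof -
  interpret comm_group "A_group s"
    by (rule comm_group_A_group)
  have "(inv\<^bsub>A_group s\<^esub> x) p = - x p"
  proof -
    have "(inv\<^bsub>A_group s\<^esub> x \<otimes>\<^bsub>A_group s\<^esub> x) p = \<one>\<^bsub>A_group s\<^esub> p"
      using assms(1) by simp
    then show ?thesis
      using assms(2) by (simp add: mult_A_group one_A_group)
  qed
  then show ?thesis
    using assms(1) int_pow_neg[of x 1] by (cases "even i") simp_all
qed

lemma finprod_A_group:
  assumes "finite K" "f \<in> K \<rightarrow> carrier (A_group s)" "p \<in> s"
  shows "finprod (A_group s) f K p = (\<Sum>i\<in>K. f i p)"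
proof -
  interpret comm_group "A_group s"
    by (rule comm_group_A_group)
  show ?thesis
    using assms(1,2) by (induction K) (simp_all add: assms(3) one_A_group mult_A_group)
qed

lemma tuples_remove_nth:
  assumes "ls \<in> tuples L leq (Suc n)" "i \<le> Suc n"
  shows "remove_nth i ls \<in> tuples L leq n"
proof -
  have i: "i < length ls"
    using assms by (simp add: tuples_def)
  have "sorted_wrt leq (take i ls @ ls ! i # drop (Suc i) ls)" "set (take i ls @ ls ! i # drop (Suc i) ls) \<subseteq> L"
    unfolding id_take_nth_drop[OF i, symmetric] using assms(1) by (simp_all add: tuples_def)
  moreover have "length (remove_nth i ls) = Suc n"
    using assms i by (simp add: remove_nth_def tuples_def)
  ultimately show ?thesis
    by (auto simp: tuples_def remove_nth_def sorted_wrt_append)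
qed

lemma chain_hd_subset:
  assumes "sorted_wrt (\<subseteq>) ls" "t \<in> set ls"
  shows "ls ! 0 \<subseteq> t"
  using assms by (cases ls) auto

lemma hd_remove_nth_subset:
  assumes "ls \<in> tuples L (\<subseteq>) (Suc n)" "i \<le> Suc n"
  shows "ls ! 0 \<subseteq> remove_nth i ls ! 0"
proof (rule chain_hd_subset)
  show "sorted_wrt (\<subseteq>) ls"
    using assms(1) by (simp add: tuples_def)
  have "length (remove_nth i ls) = Suc n"
    using tuples_remove_nth[OF assms] by (simp add: tuples_def)
  then have "remove_nth i ls ! 0 \<in> set (remove_nth i ls)"
    by (intro nth_mem) simp
  then show "remove_nth i ls ! 0 \<in> set ls"
    unfolding remove_nth_def by (auto dest: in_set_takeD in_set_dropD)
qed

lemma cochain_A_groupD: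
  "x \<in> carrier (cochain_group L leq A_group n) \<Longrightarrow> ls \<in> tuples L leq n \<Longrightarrow> x ls \<in> carrier (A_group (ls ! 0))"
  by (auto simp: cochain_group_def)

text \<open>All faces but the first keep the least set and lie in one group; the first lies over a
  possibly larger set, and its projection is restriction. At points of \<open>ls ! 0\<close> every
  term is then a plain integer.\<close>

lemma coboundary_A:
  assumes x: "x \<in> carrier (cochain_group L (\<subseteq>) A_group n)" and ls: "ls \<in> tuples L (\<subseteq>) (Suc n)"
  shows "coboundary L (\<subseteq>) A_group A_proj (Suc n) x ls = (\<lambda>p\<in>ls ! 0. cobd (\<lambda>m. x m p) ls)"
proof -
  interpret comm_group "A_group (ls ! 0)"
    by (rule comm_group_A_group)
  have len: "length ls = Suc (Suc n)"
    using ls by (simp add: tuples_def)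
  have mem: "x (remove_nth i ls) \<in> carrier (A_group (remove_nth i ls ! 0))" if "i \<le> Suc n" for i
    by (rule cochain_A_groupD[OF x tuples_remove_nth[OF ls that]])
  have nth0: "remove_nth i ls ! 0 = ls ! 0" if "i \<in> {1..Suc n}" for i
    using that len by (auto simp: remove_nth_def nth_append)
  let ?f = "\<lambda>i. x (remove_nth i ls) [^]\<^bsub>A_group (ls ! 0)\<^esub> ((- 1) ^ i :: int)"
  have f: "x (remove_nth i ls) \<in> carrier (A_group (ls ! 0))" if "i \<in> {1..Suc n}" for i
    using mem[of i] nth0[OF that] that by simp
  have "finprod (A_group (ls ! 0)) ?f {1..Suc n} p
      + restrict (x (remove_nth 0 ls)) (ls ! 0) p = cobd (\<lambda>m. x m p) ls" if p: "p \<in> ls ! 0" for p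
  proof -
    have "finprod (A_group (ls ! 0)) ?f {1..Suc n} p = (\<Sum>i\<in>{1..Suc n}. ?f i p)"
      by (rule finprod_A_group[OF _ _ p]) (use f in auto)
    also have "\<dots> = (\<Sum>i\<in>{1..Suc n}. (- 1) ^ i * x (remove_nth i ls) p)"
      by (rule sum.cong[OF refl pow_sign_A_group[OF f p]])
    finally show ?thesis
      using p unfolding cobd_eq_sum len lessThan_Suc_atMost atMost_atLeast0
      by (subst sum.atLeast_Suc_atMost) simp_all
  qed
  then show ?thesis
    unfolding coboundary_def using ls by (auto simp: mult_A_group A_proj_def intro!: restrict_ext)
qed

section \<open>The ideal and the scale\<close>

lemma I0_iff: "t \<in> I0 \<longleftrightarrow> (\<exists>f. \<forall>(i, j)\<in>t. j \<le> f i)"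
proof
  assume "t \<in> I0"
  then obtain \<F> where \<F>: "finite \<F>" "\<F> \<subseteq> range (\<lambda>f :: nat \<Rightarrow> nat. {(i, j). j \<le> f i})" "t \<subseteq> \<Union>\<F>"
    unfolding I0_def ideal_generated_def by blast
  obtain S where S: "finite S" "\<F> = (\<lambda>f :: nat \<Rightarrow> nat. {(i, j). j \<le> f i}) ` S"
    using finite_subset_image[OF \<F>(1,2)] by blast
  \<comment> \<open>Finitely many functions are bounded by their pointwise sum.\<close>
  have "j \<le> (\<Sum>f\<in>S. f i)" if ij: "(i, j) \<in> t" for i j
  proof -
    obtain f where "f \<in> S" "j \<le> f i"
      using ij \<F>(3) S(2) by auto
    then show ?thesis
      using member_le_sum[of f S "\<lambda>f. f i"] S(1) by simp
  qed
  then show "\<exists>f. \<forall>(i, j)\<in>t. j \<le> f i"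
    by (intro exI[of _ "\<lambda>i. \<Sum>f\<in>S. f i"]) auto
next
  assume "\<exists>f. \<forall>(i, j)\<in>t. j \<le> f i"
  then obtain f where "t \<subseteq> \<Union>{{(i, j). j \<le> f i}}"
    by auto
  then show "t \<in> I0"
    unfolding I0_def ideal_generated_def by blast
qed

lemma I0_subset: "s \<in> I0 \<Longrightarrow> t \<subseteq> s \<Longrightarrow> t \<in> I0"
  unfolding I0_iff by blast

lemma I0_almost:
  assumes "s \<in> I0" "finite (t - s)"
  shows "t \<in> I0"
proof -
  obtain f where f: "\<forall>(i, j)\<in>s. j \<le> f i"
    using assms(1) unfolding I0_iff by blast
  have "j \<le> max (f i) (Max (snd ` (t - s)))" if "(i, j) \<in> t" for i j
  proof (cases "(i, j) \<in> s")
    case False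
    then have "j \<in> snd ` (t - s)"
      using that by force
    then show ?thesis
      using assms(2) by (simp add: le_max_iff_disj)
  qed (use f in \<open>auto simp: le_max_iff_disj\<close>)
  then show ?thesis
    unfolding I0_iff by (intro exI[of _ "\<lambda>i. max (f i) (Max (snd ` (t - s)))"]) auto
qed

lemma le_star_finite_diff:
  assumes "f \<le>\<^sup>* g"
  shows "finite ({(i, j). j \<le> f i} - {(i, j). j \<le> g i})"
proof -
  obtain N where N: "\<And>i. N \<le> i \<Longrightarrow> f i \<le> g i"
    using assms unfolding le_star_def eventually_sequentially by blast
  have "{(i, j). j \<le> f i} - {(i, j). j \<le> g i} \<subseteq> (SIGMA i : {..<N}. {..f i})"
    using N by (force simp: not_less[symmetric])
  then show ?thesis
    by (rule finite_subset) simp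
qed

text \<open>The index set is a dominating family \<open>D\<close> of least size, so a stage \<xi> is
  itself a function. Earlier values are bounded because the two cardinals agree; staying above \<xi>
  makes the sequence cofinal, and \<open>Suc\<close> makes it strict, so that a tail of the graph of
  \<open>h \<xi>\<close> lies outside each earlier set.\<close>

lemma ex_scale:
  assumes "is_aleph n bounding_number" "is_aleph n dominating_number"
  shows "\<exists>(r :: (nat \<Rightarrow> nat) rel) a. is_aleph n r \<and> almost_increasing r a \<and>
     (\<forall>\<xi>\<in>Field r. a \<xi> \<in> I0) \<and> (\<forall>t\<in>I0. \<exists>\<xi>\<in>Field r. finite (t - a \<xi>))"
proof -
  let ?B = "{B. \<not> (\<exists>g. \<forall>f\<in>B. f \<le>\<^sup>* g)}" and ?D = "{D. \<forall>f. \<exists>g\<in>D. f \<le>\<^sup>* g}"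
  have refl: "f \<le>\<^sup>* f" for f
    by (simp add: le_star_def)
  then have "UNIV \<in> ?D"
    by blast
  have "UNIV \<in> ?B"
  proof -
    have "\<not> (\<lambda>i. Suc (g i)) \<le>\<^sup>* g" for g
      by (simp add: le_star_def)
    then show ?thesis
      by blast
  qed
  define r where "r = dominating_number"
  have "?D \<noteq> {}"
    using \<open>UNIV \<in> ?D\<close> by blast
  then obtain D where D: "\<forall>f. \<exists>g\<in>D. f \<le>\<^sup>* g" "r = |D|"
    using min_card(1)[of ?D] unfolding r_def dominating_number_def by auto
  have r: "is_aleph n r"
    using assms(2) r_def by simp
  have F: "Field r = D"
    unfolding D(2) by (rule Field_card_of)
  have bounded: "\<exists>g. \<forall>f\<in>B. f \<le>\<^sup>* g" if "|B| <o r" for B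
  proof (rule ccontr)
    assume "\<not> ?thesis"
    then have "bounding_number \<le>o |B|"
      unfolding bounding_number_def by (intro min_card(2)) auto
    moreover have "r =o bounding_number"
      by (rule is_aleph_unique[OF r assms(1)])
    ultimately have "r \<le>o |B|"
      using ordIso_ordLeq_trans by blast
    then show False
      using that not_ordLess_ordLeq by blast
  qed
  have "\<exists>h. \<forall>\<xi>\<in>Field r. h \<xi> \<in> UNIV \<and> \<xi> \<le>\<^sup>* h \<xi> \<and> (\<forall>\<eta>\<in>underS r \<xi>. (\<forall>\<^sub>F i in sequentially. h \<eta> i < h \<xi> i))"
  proof (rule well_order_recursion[OF is_aleph_Well_order[OF r]])
    fix \<xi> and f :: "(nat \<Rightarrow> nat) \<Rightarrow> nat \<Rightarrow> nat" assume \<xi>: "\<xi> \<in> Field r"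
    have "|f ` underS r \<xi>| <o r"
      by (rule ordLeq_ordLess_trans[OF card_of_image card_of_underS[OF is_aleph_Card_order[OF r] \<xi>]])
    then obtain g where g: "\<forall>x\<in>f ` underS r \<xi>. x \<le>\<^sup>* g"
      using bounded by blast
    show "\<exists>\<gamma>\<in>UNIV. \<xi> \<le>\<^sup>* \<gamma> \<and> (\<forall>\<eta>\<in>underS r \<xi>. (\<forall>\<^sub>F i in sequentially. f \<eta> i < \<gamma> i))"
    proof (intro bexI conjI ballI)
      show "\<xi> \<le>\<^sup>* (\<lambda>i. Suc (max (g i) (\<xi> i)))"
        unfolding le_star_def by (intro always_eventually) auto
      fix \<eta> assume "\<eta> \<in> underS r \<xi>"
      then have "\<forall>\<^sub>F i in sequentially. f \<eta> i \<le> g i"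
        using g by (auto simp: le_star_def)
      then show "\<forall>\<^sub>F i in sequentially. f \<eta> i < Suc (max (g i) (\<xi> i))"
        by (rule eventually_mono) auto
    qed simp
  qed
  then obtain h where h: "\<And>\<xi>. \<xi> \<in> Field r \<Longrightarrow> \<xi> \<le>\<^sup>* h \<xi>"
    "\<And>\<xi> \<eta>. \<xi> \<in> Field r \<Longrightarrow> \<eta> \<in> underS r \<xi> \<Longrightarrow> (\<forall>\<^sub>F i in sequentially. h \<eta> i < h \<xi> i)"
    by blast
  define a where "a \<xi> = {(i, j). j \<le> h \<xi> i}" for \<xi>
  have "almost_increasing r a"
    unfolding almost_increasing_def
  proof safe
    fix \<xi> \<eta> assume *: "\<xi> \<in> Field r" "\<eta> \<in> underS r \<xi>"
    have lt: "\<forall>\<^sub>F i in sequentially. h \<eta> i < h \<xi> i"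
      by (rule h(2)[OF *])
    then have "h \<eta> \<le>\<^sup>* h \<xi>"
      unfolding le_star_def by (rule eventually_mono) simp
    then show "finite (a \<eta> - a \<xi>)"
      unfolding a_def by (rule le_star_finite_diff)
    obtain N where N: "\<And>i. N \<le> i \<Longrightarrow> h \<eta> i < h \<xi> i"
      using lt unfolding eventually_sequentially by blast
    have "(\<lambda>i. (i, h \<xi> i)) ` {N..} \<subseteq> a \<xi> - a \<eta>"
      using N by (force simp: a_def not_le)
    moreover have "infinite ((\<lambda>i. (i, h \<xi> i)) ` {N..})"
      by (subst finite_image_iff) (auto simp: inj_on_def infinite_Ici)
    moreover assume "finite (a \<xi> - a \<eta>)"
    ultimately show False
      using finite_subset by blast
  qed
  moreover have "a \<xi> \<in> I0" for \<xi>
    unfolding I0_iff a_def by (intro exI[of _ "h \<xi>"]) auto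
  moreover have "\<exists>\<xi>\<in>Field r. finite (t - a \<xi>)" if "t \<in> I0" for t
  proof -
    obtain f where f: "t \<subseteq> {(i, j). j \<le> f i}"
      using \<open>t \<in> I0\<close> unfolding I0_iff by blast
    obtain \<xi> where \<xi>: "\<xi> \<in> Field r" "f \<le>\<^sup>* \<xi>"
      using D(1) F by blast
    have "\<forall>\<^sub>F i in sequentially. f i \<le> \<xi> i \<and> \<xi> i \<le> h \<xi> i"
      using \<xi> h(1)[OF \<xi>(1)] unfolding le_star_def by (intro eventually_conj)
    then have "f \<le>\<^sup>* h \<xi>"
      unfolding le_star_def by (rule eventually_mono) auto
    then have "finite ({(i, j). j \<le> f i} - a \<xi>)"
      unfolding a_def by (rule le_star_finite_diff)
    then have "finite (t - a \<xi>)"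
      by (rule rev_finite_subset) (use f in auto)
    then show ?thesis
      using \<xi>(1) by blast
  qed
  ultimately show ?thesis
    using r by blast
qed

section \<open>From a trivial quotient back to the scale\<close>

lemma trivial_lim_A:
  assumes triv: "carrier (lim_A (Suc n)) = {\<one>\<^bsub>lim_A (Suc n)\<^esub>}" and x: "x \<in> cocycles I0 (\<subseteq>) A_group A_proj (Suc n)"
  shows "\<exists>y\<in>carrier (cochain_group I0 (\<subseteq>) A_group n). x = coboundary I0 (\<subseteq>) A_group A_proj (Suc n) y"
proof -
  let ?C = "cochain_group I0 (\<subseteq>) A_group (Suc n)"
  let ?H = "coboundaries I0 (\<subseteq>) A_group A_proj (Suc n)"
  let ?Z = "cocycles I0 (\<subseteq>) A_group A_proj (Suc n)"
  \<comment> \<open>The zero cochain. Its coboundary shows that \<open>x\<close> lies in its own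
    coset, and the only coset is the set of coboundaries.\<close>
  let ?y = "\<lambda>ls\<in>tuples I0 (\<subseteq>) n. \<lambda>p\<in>ls ! 0. 0 :: int"
  have y: "?y \<in> carrier (cochain_group I0 (\<subseteq>) A_group n)"
    by (auto simp: cochain_group_def carrier_A_group)
  let ?h = "coboundary I0 (\<subseteq>) A_group A_proj (Suc n) ?y"
  have xC: "x \<in> carrier ?C"
    using x by (simp add: cocycles_def kernel_def)
  have h: "?h ls p = 0" if "ls \<in> tuples I0 (\<subseteq>) (Suc n)" "p \<in> ls ! 0" for ls p
  proof -
    have "?y (remove_nth i ls) p = 0" if i: "i \<le> Suc n" for i
      using tuples_remove_nth[OF \<open>ls \<in> _\<close> i] hd_remove_nth_subset[OF \<open>ls \<in> _\<close> i] \<open>p \<in> _\<close> by auto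
    moreover have "length ls = Suc (Suc n)"
      using that by (simp add: tuples_def)
    ultimately have "cobd (\<lambda>m. ?y m p) ls = 0"
      unfolding cobd_eq_sum by (intro sum.neutral) auto
    then show ?thesis
      unfolding coboundary_A[OF y that(1)] using that by simp
  qed
  have "?h \<otimes>\<^bsub>?C\<^esub> x = x"
  proof -
    have "?h \<otimes>\<^bsub>?C\<^esub> x = (\<lambda>ls\<in>tuples I0 (\<subseteq>) (Suc n). \<lambda>p\<in>ls ! 0. ?h ls p + x ls p)"
      by (simp add: cochain_group_def mult_A_group)
    also have "\<dots> = (\<lambda>ls\<in>tuples I0 (\<subseteq>) (Suc n). x ls)"
    proof (rule restrict_ext)
      fix ls assume ls: "ls \<in> tuples I0 (\<subseteq>) (Suc n)"
      have "x ls \<in> extensional (ls ! 0)"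
        using cochain_A_groupD[OF xC ls] by (simp add: carrier_A_group)
      then have "x ls = restrict (x ls) (ls ! 0)"
        by (simp add: extensional_restrict)
      also have "\<dots> = (\<lambda>p\<in>ls ! 0. ?h ls p + x ls p)"
        by (rule restrict_ext) (simp add: h[OF ls])
      finally show "(\<lambda>p\<in>ls ! 0. ?h ls p + x ls p) = x ls" ..
    qed
    also have "\<dots> = x"
      using xC by (simp add: cochain_group_def PiE_def extensional_restrict)
    finally show ?thesis .
  qed
  moreover have "?h \<in> ?H"
    unfolding coboundaries_def using y by auto
  ultimately have "x \<in> ?H #>\<^bsub>?C\<lparr>carrier := ?Z\<rparr>\<^esub> x"
    unfolding r_coset_def by force
  moreover have "?H #>\<^bsub>?C\<lparr>carrier := ?Z\<rparr>\<^esub> x = ?H"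
    using triv x unfolding lim_A_def derived_limit_def carrier_FactGroup by (auto simp: FactGroup_def)
  ultimately show ?thesis
    unfolding coboundaries_def by auto
qed

theorem theorem3p7:
  fixes n :: nat
  assumes "n \<ge> 1"
    and "is_aleph n bounding_number"
    and "is_aleph n dominating_number"
    and "\<And>k (r :: (nat \<Rightarrow> nat) rel). k < n \<Longrightarrow> is_aleph (Suc k) r \<Longrightarrow> weak_diamond r (cof_points k r)"
  shows "carrier (lim_A n) \<noteq> {\<one>\<^bsub>lim_A n\<^esub>}"
proof
  assume triv: "carrier (lim_A n) = {\<one>\<^bsub>lim_A n\<^esub>}"
  obtain m where m: "n = Suc m"
    using assms(1) by (cases n) auto
  obtain r :: "(nat \<Rightarrow> nat) rel" and a where r: "is_aleph n r" and incr: "almost_increasing r a"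
    and aI0: "\<And>\<xi>. \<xi> \<in> Field r \<Longrightarrow> a \<xi> \<in> I0" and dom: "\<And>t. t \<in> I0 \<Longrightarrow> \<exists>\<xi>\<in>Field r. finite (t - a \<xi>)"
    using ex_scale[OF assms(2,3)] by blast
  \<comment> \<open>As \<open>n\<close> is positive, chains of length \<open>n\<close> are nonempty,
    and the bound \<open>UNIV\<close> never stands in for a least set.\<close>
  obtain \<phi> :: "(nat \<Rightarrow> nat) list \<Rightarrow> nat \<times> nat \<Rightarrow> int" where \<phi>: "nontriv (Field r) a UNIV n \<phi>"
    using ex_nontriv[OF r incr _ assms(4), of UNIV] by auto
  \<comment> \<open>For finite supports it is enough that \<open>a (\<pi> t)\<close> almost contains
    \<open>t\<close>. On finite modifications of \<open>a \<eta>\<close>, however, the index must be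
    \<eta> itself, so that \<Phi> gives back \<phi>.\<close>
  have "\<exists>\<xi>. \<xi> \<in> Field r \<and> finite (t - a \<xi>) \<and> ((\<exists>\<eta>\<in>Field r. almost_eq t (a \<eta>)) \<longrightarrow> almost_eq t (a \<xi>))"
    if "t \<in> I0" for t
    using dom[OF that] by (cases "\<exists>\<eta>\<in>Field r. almost_eq t (a \<eta>)") (auto simp: almost_eq_def)
  then obtain \<pi> where \<pi>: "\<And>t. t \<in> I0 \<Longrightarrow> \<pi> t \<in> Field r" "\<And>t. t \<in> I0 \<Longrightarrow> finite (t - a (\<pi> t))"
    "\<And>t \<eta>. t \<in> I0 \<Longrightarrow> \<eta> \<in> Field r \<Longrightarrow> almost_eq t (a \<eta>) \<Longrightarrow> almost_eq t (a (\<pi> t))"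
    by metis
  have no_eq: "\<not> (almost_eq t (a \<xi>) \<and> almost_eq t (a \<eta>))" if "\<xi> \<in> Field r" "\<eta> \<in> underS r \<xi>" for t \<xi> \<eta>
  proof
    assume "almost_eq t (a \<xi>) \<and> almost_eq t (a \<eta>)"
    then have "finite ((a \<xi> - t) \<union> (t - a \<eta>))"
      by (simp add: almost_eq_def)
    then have "finite (a \<xi> - a \<eta>)"
      by (rule rev_finite_subset) auto
    then show False
      using incr that unfolding almost_increasing_def by blast
  qed
  have \<pi>_eq: "\<pi> t = \<eta>" if "t \<in> I0" "\<eta> \<in> Field r" "almost_eq t (a \<eta>)" for t \<eta>
    using well_order_cases[OF is_aleph_Well_order[OF r] \<pi>(1)[OF that(1)] that(2)] \<pi>(3)[OF that]
      no_eq[of "\<pi> t" \<eta> t] no_eq[of \<eta> "\<pi> t" t] \<pi>(1)[OF that(1)] that by auto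
  define \<Phi> where "\<Phi> l p = \<phi> (map \<pi> l) p" for l p
  \<comment> \<open>\<Phi> may have infinite supports and need not be a cochain of the system. Its
    coboundary is one: the least set of a chain is almost contained in all the
    \<open>a (\<pi> t)\<close>, on whose intersection the cocycle equation holds up to finitely many
    points.\<close>
  define x where "x = (\<lambda>ls\<in>tuples I0 (\<subseteq>) n. \<lambda>p\<in>ls ! 0. cobd (\<lambda>m. \<Phi> m p) ls)"
  have x: "x \<in> carrier (cochain_group I0 (\<subseteq>) A_group n)"
  proof -
    have "finite {p \<in> ls ! 0. cobd (\<lambda>m. \<Phi> m p) ls \<noteq> 0}" if ls: "ls \<in> tuples I0 (\<subseteq>) n" for ls
    proof -
      have ls': "set ls \<subseteq> I0" "length ls = Suc n" "sorted_wrt (\<subseteq>) ls"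
        using ls by (auto simp: tuples_def)
      have "aeq (\<Inter>i\<in>set (map \<pi> ls). a i) (\<lambda>p. cobd (\<lambda>m. \<phi> m p) (map \<pi> ls)) (\<lambda>_. 0)"
        using conjunct1[OF \<phi>[unfolded nontriv_def], unfolded is_cobd_def, rule_format, of "map \<pi> ls"]
          ls' \<pi>(1) by auto
      moreover have "finite (ls ! 0 - (\<Inter>i\<in>set (map \<pi> ls). a i))"
      proof (rule finite_subset)
        show "ls ! 0 - (\<Inter>i\<in>set (map \<pi> ls). a i) \<subseteq> (\<Union>t\<in>set ls. t - a (\<pi> t))"
          using chain_hd_subset[OF ls'(3)] by auto
        show "finite (\<Union>t\<in>set ls. t - a (\<pi> t))"
          using \<pi>(2) ls'(1) by auto
      qed
      ultimately have "aeq (ls ! 0) (\<lambda>p. cobd (\<lambda>m. \<phi> m p) (map \<pi> ls)) (\<lambda>_. 0)"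
        by (rule aeq_mono)
      then show ?thesis
        by (simp add: aeq_def cobd_map \<Phi>_def)
    qed
    then show ?thesis
      by (auto simp: x_def cochain_group_def carrier_A_group cong: conj_cong)
  qed
  have "x \<in> cocycles I0 (\<subseteq>) A_group A_proj n"
  proof -
    have "coboundary I0 (\<subseteq>) A_group A_proj (Suc n) x ls = (\<lambda>p\<in>ls ! 0. 0)"
      if ls: "ls \<in> tuples I0 (\<subseteq>) (Suc n)" for ls
      unfolding coboundary_A[OF x ls]
    proof (rule restrict_ext)
      fix p assume p: "p \<in> ls ! 0"
      have "length ls = Suc (Suc n)"
        using ls by (simp add: tuples_def)
      moreover have "x (remove_nth i ls) p = cobd (\<lambda>k. \<Phi> k p) (remove_nth i ls)" if "i \<le> Suc n" for i
        using tuples_remove_nth[OF ls that] subsetD[OF hd_remove_nth_subset[OF ls that] p]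
        by (simp add: x_def)
      ultimately have "cobd (\<lambda>m. x m p) ls = cobd (\<lambda>m. cobd (\<lambda>k. \<Phi> k p) m) ls"
        unfolding cobd_eq_sum[of _ ls] by (intro sum.cong refl) simp
      then show "cobd (\<lambda>m. x m p) ls = 0"
        by (simp add: cobd_cobd)
    qed
    then have "coboundary I0 (\<subseteq>) A_group A_proj (Suc n) x = \<one>\<^bsub>cochain_group I0 (\<subseteq>) A_group (Suc n)\<^esub>"
      by (auto simp: fun_eq_iff cochain_group_def one_A_group coboundary_def)
    then show ?thesis
      using x by (simp add: cocycles_def kernel_def)
  qed
  then obtain y where y: "y \<in> carrier (cochain_group I0 (\<subseteq>) A_group m)"
    and xy: "x = coboundary I0 (\<subseteq>) A_group A_proj n y"
    using trivial_lim_A[of m x] triv m by auto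
  define \<Psi> where "\<Psi> l p = \<Phi> l p - y l p" for l p
  have \<Psi>: "cobd (\<lambda>k. \<Psi> k p) ls = 0" if ls: "ls \<in> tuples I0 (\<subseteq>) n" and p: "p \<in> ls ! 0" for ls p
  proof -
    have "x ls p = cobd (\<lambda>k. y k p) ls"
      using coboundary_A[OF y, of ls] ls p m xy by simp
    moreover have "x ls p = cobd (\<lambda>k. \<Phi> k p) ls"
      using ls p by (simp add: x_def)
    ultimately show ?thesis
      by (simp add: \<Psi>_def cobd_diff)
  qed
  \<comment> \<open>For \<open>p\<close> in the least set of \<open>ls\<close>, the list
    \<open>{p} # ls\<close> is again a chain in the ideal, and the coboundary of \<Psi> vanishes
    there at \<open>p\<close>. The vertex may depend on \<open>p\<close> because \<open>cobd\<close>
    is computed pointwise.\<close>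
  define z where "z l p = \<Psi> ({p} # l) p" for l p
  have "chain_triv (Field r) a UNIV n z \<phi>"
    unfolding chain_triv_def
  proof (intro allI impI)
    fix "is" and ls :: "(nat \<times> nat) set list"
    assume len: "length ls = n" and sorted: "sorted_wrt (\<subseteq>) ls"
      and l: "list_all2 (\<lambda>i t. i \<in> Field r \<and> t \<subseteq> UNIV \<and> almost_eq t (a i)) is ls"
    have lI0: "list_all2 (\<lambda>i t. t \<in> I0 \<and> \<pi> t = i) is ls"
    proof (rule list_all2_mono[OF l])
      fix i and t :: "(nat \<times> nat) set" assume *: "i \<in> Field r \<and> t \<subseteq> UNIV \<and> almost_eq t (a i)"
      then have "t \<in> I0"
        using I0_almost[OF aI0, of i t] by (simp add: almost_eq_def)
      then show "t \<in> I0 \<and> \<pi> t = i"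
        using \<pi>_eq * by blast
    qed
    have "map \<pi> ls = is"
      using lI0 by (auto simp: list_all2_conv_all_nth intro: nth_equalityI)
    have ls: "ls \<in> tuples I0 (\<subseteq>) m"
      using lI0 sorted len m by (auto simp: tuples_def list_all2_conv_all_nth in_set_conv_nth)
    have hd: "hd (ls @ [UNIV]) = ls ! 0"
      using len m by (cases ls) auto
    have "cobd (\<lambda>k. z k p) ls = \<Psi> ls p" if p: "p \<in> ls ! 0" for p
    proof -
      have "{p} # ls \<in> tuples I0 (\<subseteq>) n"
      proof -
        have "ls ! 0 \<in> I0"
          using ls by (auto simp: tuples_def)
        then have "{p} \<in> I0"
          by (rule I0_subset) (use p in simp)
        moreover have "\<forall>t\<in>set ls. {p} \<subseteq> t"
          using chain_hd_subset[OF sorted] p by auto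
        ultimately show ?thesis
          using ls len m by (simp add: tuples_def)
      qed
      from \<Psi>[OF this, of p] show ?thesis
        by (simp add: cobd.simps z_def)
    qed
    \<comment> \<open>Dropping \<open>y\<close> costs finitely many points, which turns the exact
      trivialization of \<Psi> into one of \<phi> modulo finite sets.\<close>
    moreover have "finite {p \<in> ls ! 0. y ls p \<noteq> 0}"
      using cochain_A_groupD[OF y ls] by (simp add: carrier_A_group)
    ultimately show "aeq (hd (ls @ [UNIV])) (\<lambda>p. cobd (\<lambda>k. z k p) ls) (\<phi> is)"
      unfolding hd aeq_def by (simp add: \<Psi>_def \<Phi>_def \<open>map \<pi> ls = is\<close> cong: conj_cong)
  qed
  then show False
    using \<phi> unfolding nontriv_def by blast
qed

end
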